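(* Let $k$ be a positive integer, and let $G$ be a connected graph of order $n$ with minimum degree $\delta$. If $n \geq 12\delta - 2k + 1$, $\delta \geq 2k + 1$ and \[ \mu(G) \leq \mu\bigl(K_{\delta} \vee (K_{n - 2\delta + 2k - 1} \cup (\delta - 2k + 1)K_1)\bigr), \] then $G$ is fractional $k$-extendable, unless $G \cong K_{\delta} \vee (K_{n - 2\delta + 2k - 1} \cup (\delta - 2k + 1)K_1)$.
   Context: All graphs are finite and simple. For a connected graph $G$ with vertices $v_1,\dots,v_n$, the distance matrix is $\mathcal{D}(G) = (d_{i,j})$, where $d_{i,j}$ is the length of a shortest path between $v_i$ and $v_j$; $\mu(G)$ (the distance spectral radius) is the largest eigenvalue of $\mathcal{D}(G)$. $K_m$ is the complete graph on $m$ vertices, $\cup$ denotes disjoint union of graphs, $tK_1$ is the graph with $t$ vertices and no edges, and the join $G_1 \vee G_2$ is obtained from the disjoint union of $G_1$ and $G_2$ by adding every edge between $V(G_1)$ and $V(G_2)$. A $k$-matching is a set of $k$ pairwise vertex-disjoint edges. A fractional perfect matching of $G$ is a function $h: E(G) \to [0,1]$ such that $\sum_{e \in E_G(v)} h(e) = 1$ for every $v \in V(G)$, where $E_G(v)$ is the set of edges incident with $v$. A graph $G$ with at least $2k+2$ vertices is fractional $k$-extendable if it has a $k$-matching and for every $k$-matching $M$ of $G$ there is a fractional perfect matching $h$ of $G$ with $h(e) = 1$ for all $e \in M$. *)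

theory Defs
  imports
    "Graph_Theory.Graph_Theory"
    "Jordan_Normal_Form.Spectral_Radius"
begin

text \<open>
  A finite simple graph is a \<open>pair_graph\<close>: an undirected edge between \<open>u\<close> and \<open>v\<close> is the
  pair of arcs \<open>(u, v)\<close>, \<open>(v, u)\<close>. The undirected edges are recovered as two-element vertex sets,
  so that functions on edges and sets of edges do not see the orientation.
\<close>

definition edges :: "'a pair_pre_digraph \<Rightarrow> 'a set set" where
  "edges G = {{u, v} | u v. (u, v) \<in> parcs G}"

text \<open>In a symmetric digraph the out-degree of a vertex is its number of neighbours.\<close>

definition min_degree :: "'a pair_pre_digraph \<Rightarrow> nat" where
  "min_degree G = Min (out_degree (with_proj G) ` pverts G)"


section \<open>Distance spectral radius\<close>

definition graph_dist :: "'a pair_pre_digraph \<Rightarrow> 'a \<Rightarrow> 'a \<Rightarrow> nat" where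
  "graph_dist G u v = (LEAST l. \<exists>p. pre_digraph.apath (with_proj G) u p v \<and> length p = l)"

definition distance_matrix :: "'a pair_pre_digraph \<Rightarrow> 'a list \<Rightarrow> real mat" where
  "distance_matrix G vs =
     mat (length vs) (length vs) (\<lambda>(i, j). real (graph_dist G (vs ! i) (vs ! j)))"

text \<open>
  The enumeration of the vertices is chosen arbitrarily: another one conjugates the distance
  matrix by a permutation matrix and leaves the spectrum unchanged. The distance matrix is real
  and symmetric, so its spectrum over the reals consists of all of its eigenvalues.
\<close>

definition distance_spectral_radius :: "'a pair_pre_digraph \<Rightarrow> real" where
  "distance_spectral_radius G =
     Max (spectrum (distance_matrix G (SOME vs. distinct vs \<and> set vs = pverts G)))"


section \<open>Graph operations\<close>

definition complete_graph :: "nat \<Rightarrow> nat pair_pre_digraph" where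
  "complete_graph m = \<lparr> pverts = {..<m}, parcs = {(i, j). i < m \<and> j < m \<and> i \<noteq> j} \<rparr>"

definition empty_graph :: "nat \<Rightarrow> nat pair_pre_digraph" where
  "empty_graph m = \<lparr> pverts = {..<m}, parcs = {} \<rparr>"

definition disjoint_union ::
  "'a pair_pre_digraph \<Rightarrow> 'b pair_pre_digraph \<Rightarrow> ('a + 'b) pair_pre_digraph" where
  "disjoint_union G H =
     \<lparr> pverts = pverts G <+> pverts H,
       parcs = map_prod Inl Inl ` parcs G \<union> map_prod Inr Inr ` parcs H \<rparr>"

definition join ::
  "'a pair_pre_digraph \<Rightarrow> 'b pair_pre_digraph \<Rightarrow> ('a + 'b) pair_pre_digraph" where
  "join G H =
     \<lparr> pverts = pverts (disjoint_union G H),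
       parcs = parcs (disjoint_union G H)
         \<union> (Inl ` pverts G) \<times> (Inr ` pverts H) \<union> (Inr ` pverts H) \<times> (Inl ` pverts G) \<rparr>"

lemma pair_graph_complete_graph: "pair_graph (complete_graph m)"
proof -
  have "finite {(i, j). i < m \<and> j < m \<and> i \<noteq> j}"
    by (rule finite_subset[of _ "{..<m} \<times> {..<m}"]) auto
  then show ?thesis
    by unfold_locales (auto simp: complete_graph_def symmetric_def sym_def)
qed

lemma complete_digraph_complete_graph: "complete_digraph m (with_proj (complete_graph m))"
proof -
  interpret pair_graph "complete_graph m" by (rule pair_graph_complete_graph)
  show ?thesis
    unfolding complete_digraph_def using graph_axioms
    by (auto simp: complete_graph_def pair_graphD_graph[unfolded complete_graph_def])
qed

lemma pair_graph_empty_graph: "pair_graph (empty_graph m)"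
  by unfold_locales (auto simp: empty_graph_def symmetric_def)

lemma pair_graph_disjoint_union:
  assumes "pair_graph G" "pair_graph H"
  shows "pair_graph (disjoint_union G H)"
proof -
  interpret G: pair_graph G by fact
  interpret H: pair_graph H by fact
  show ?thesis
    by unfold_locales
      (auto simp: disjoint_union_def symmetric_def
        dest: G.wellformed' H.wellformed' G.no_loops' H.no_loops'
        intro!: symI intro: rev_image_eqI G.arcs_symmetric H.arcs_symmetric)
qed

lemma pair_graph_join:
  assumes "pair_graph G" "pair_graph H"
  shows "pair_graph (join G H)"
proof -
  interpret U: pair_graph "disjoint_union G H"
    using assms by (rule pair_graph_disjoint_union)
  have fin: "finite (pverts G)" "finite (pverts H)"
    using assms by (simp_all add: pair_graph_def pair_digraph_def pair_fin_digraph_def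
        pair_fin_digraph_axioms_def)
  show ?thesis
    using fin U.pair_finite_arcs
    by unfold_locales
      (auto simp: join_def symmetric_def dest: U.wellformed' U.no_loops'
        intro!: symI intro: U.arcs_symmetric, auto simp: disjoint_union_def)
qed


section \<open>Fractional extendability\<close>

definition k_matching :: "'a pair_pre_digraph \<Rightarrow> nat \<Rightarrow> 'a set set \<Rightarrow> bool" where
  "k_matching G k M \<longleftrightarrow> M \<subseteq> edges G \<and> finite M \<and> card M = k \<and> pairwise disjnt M"

definition fractional_perfect_matching :: "'a pair_pre_digraph \<Rightarrow> ('a set \<Rightarrow> real) \<Rightarrow> bool" where
  "fractional_perfect_matching G h \<longleftrightarrow>
     (\<forall>e \<in> edges G. 0 \<le> h e \<and> h e \<le> 1) \<and>
     (\<forall>v \<in> pverts G. (\<Sum>e \<in> {e \<in> edges G. v \<in> e}. h e) = 1)"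

definition fractional_extendable :: "nat \<Rightarrow> 'a pair_pre_digraph \<Rightarrow> bool" where
  "fractional_extendable k G \<longleftrightarrow>
     2 * k + 2 \<le> card (pverts G) \<and>
     (\<exists>M. k_matching G k M) \<and>
     (\<forall>M. k_matching G k M \<longrightarrow>
        (\<exists>h. fractional_perfect_matching G h \<and> (\<forall>e \<in> M. h e = 1)))"

text \<open>
  The graph \<open>K\<^sub>\<delta> \<or> (K\<^bsub>n - 2\<delta> + 2k - 1\<^esub> \<union> (\<delta> - 2k + 1) K\<^sub>1)\<close>. For \<open>2k \<le> \<delta>\<close> and \<open>2\<delta> + 1 \<le> n + 2k\<close>
  the natural-number subtractions below do not truncate.
\<close>

definition extremal_graph :: "nat \<Rightarrow> nat \<Rightarrow> nat \<Rightarrow> (nat + (nat + nat)) pair_pre_digraph" where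
  "extremal_graph n \<delta> k =
     join (complete_graph \<delta>)
       (disjoint_union (complete_graph (n + 2 * k - 2 * \<delta> - 1)) (empty_graph (\<delta> + 1 - 2 * k)))"

end

theory Submission
  imports Defs "HOL-Analysis.Function_Topology"
begin

text \<open>
Suppose \<open>G\<close> is not fractional \<open>k\<close>-extendable. Its minimum degree is large enough for greedy
\<open>k\<close>-matchings, so some \<open>k\<close>-matching \<open>M\<close> lies in no fractional perfect matching. Hall's theorem for
the bipartite double cover of \<open>G - \<Union>M\<close> then yields an obstruction: disjoint sets \<open>S\<close>, \<open>T\<close> of
vertices with \<open>|T| = |S| - 2k + 1\<close> such that all neighbours of \<open>T\<close> lie in \<open>S\<close>
(\<open>not_fractional_extendable_imp_split\<close>). A vertex of \<open>T\<close> has at least \<open>\<delta>\<close> neighbours, so \<open>|S| \<ge> \<delta>\<close>.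
Every distance in \<open>G\<close> is at least the distance \<open>split_dist S T\<close> in the graph obtained by adding all
edges except those between \<open>T\<close> and the complement of \<open>S\<close>. For \<open>|S| = \<delta>\<close> that completed graph is the
extremal graph \<open>H\<close>.

The spectral radii are compared with a single test vector. The distance matrix of \<open>H\<close> has a
nonnegative eigenvector \<open>x\<close> for its largest eigenvalue \<open>\<mu>\<close>, and the eigenvalue equations show
that \<open>x\<close> takes three positive values: \<open>a\<close> on the \<open>\<delta>\<close> dominating vertices, \<open>c\<close> on the
\<open>t = \<delta> - 2k + 1\<close> independent ones and \<open>b\<close> on the remaining ones, with \<open>c \<le> 2b\<close>
(\<open>split_dist_perron_vector\<close>). Transplant \<open>x\<close> to a vector \<open>y\<close> on \<open>G\<close>: \<open>a\<close> on \<open>\<delta>\<close> vertices of \<open>S\<close>,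
\<open>c\<close> on \<open>t\<close> vertices of \<open>T\<close>, and \<open>b\<close> elsewhere. With \<open>r = |S| - \<delta>\<close>, the quadratic form of
\<open>split_dist S T\<close> at \<open>y\<close> exceeds \<open>\<mu>\<close>, its value for \<open>H\<close> at \<open>x\<close>, by
  \<open>r b ((r - 1) b + 2 (n - \<delta> - t - 2r) b - 2 t c)\<close>,
which is positive for \<open>r > 0\<close> because \<open>n\<close> is large compared with \<open>\<delta>\<close> and \<open>c \<le> 2b\<close>
(\<open>block_form_gain\<close>). Since \<open>y\<close> has norm 1, the Rayleigh quotient of \<open>G\<close> at \<open>y\<close> would be larger than
\<open>\<mu>\<close>, against the hypothesis on the spectral radii. Hence \<open>r = 0\<close>, and equality holds throughout;
as \<open>y\<close> is positive, the distances of \<open>G\<close> agree with \<open>split_dist S T\<close>, and \<open>G\<close> is isomorphic to \<open>H\<close>.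
\<close>

section \<open>Distances\<close>

lemma graph_dist_commute:
  assumes "pair_graph G"
  shows "graph_dist G u v = graph_dist G v u"
proof -
  interpret pair_graph G by fact
  have len: "length (rev_path p) = length p" for p :: "('a \<times> 'a) list"
    by (induction p) auto
  have "\<exists>q. apath v q u \<and> length q = length p" if "apath u p v" for u p v
    using that by (intro exI[of _ "rev_path p"]) (simp add: len)
  then have "(\<exists>p. apath u p v \<and> length p = l) \<longleftrightarrow> (\<exists>p. apath v p u \<and> length p = l)" for l
    by metis
  then show ?thesis by (simp add: graph_dist_def)
qed

lemma graph_dist_le_apath:
  "pre_digraph.apath (with_proj G) u p v \<Longrightarrow> graph_dist G u v \<le> length p"
  unfolding graph_dist_def by (rule Least_le) blast

lemma graph_dist_attained:
  assumes "pre_digraph.apath (with_proj G) u p v"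
  obtains q where "pre_digraph.apath (with_proj G) u q v" "length q = graph_dist G u v"
proof -
  have "\<exists>q. pre_digraph.apath (with_proj G) u q v \<and> length q = graph_dist G u v"
    unfolding graph_dist_def by (rule LeastI_ex) (use assms in blast)
  then show thesis using that by blast
qed

lemma graph_dist_self:
  assumes "pair_graph G" "u \<in> pverts G"
  shows "graph_dist G u u = 0"
proof -
  interpret pair_graph G by fact
  have "apath u [] u" using assms by (simp add: apath_Nil_iff)
  then show ?thesis using graph_dist_le_apath by fastforce
qed

lemma graph_dist_ge_1:
  assumes "pair_graph G" "pre_digraph.apath (with_proj G) u p v" "u \<noteq> v"
  shows "1 \<le> graph_dist G u v"
proof -
  interpret pair_graph G by fact
  obtain q where q: "apath u q v" "length q = graph_dist G u v"
    using graph_dist_attained[OF assms(2)] by auto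
  show ?thesis using q assms(3) by (cases q) (auto simp: apath_Nil_iff)
qed

lemma graph_dist_ge_2:
  assumes "pair_graph G" "pre_digraph.apath (with_proj G) u p v" "u \<noteq> v" "(u, v) \<notin> parcs G"
  shows "2 \<le> graph_dist G u v"
proof -
  interpret pair_graph G by fact
  obtain q where q: "apath u q v" "length q = graph_dist G u v"
    using graph_dist_attained[OF assms(2)] by auto
  show ?thesis
  proof (cases q)
    case Nil
    then show ?thesis using q assms(3) by (auto simp: apath_Nil_iff)
  next
    case (Cons e r)
    have "r \<noteq> []"
      using q(1) assms(4) unfolding Cons by (cases e) (auto simp: apath_simps)
    then show ?thesis using q(2) Cons by (cases r) auto
  qed
qed

lemma apath_arc:
  assumes "pair_graph G" "(u, v) \<in> parcs G"
  shows "pre_digraph.apath (with_proj G) u [(u, v)] v"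
proof -
  interpret pair_graph G by fact
  show ?thesis using assms(2) by (auto simp: apath_simps dest: wellformed' no_loops')
qed

lemma graph_dist_adjacent:
  assumes "pair_graph G" "(u, v) \<in> parcs G"
  shows "graph_dist G u v = 1"
proof -
  interpret pair_graph G by fact
  have "u \<noteq> v" using assms(2) by (auto dest: no_loops')
  then have "1 \<le> graph_dist G u v" using graph_dist_ge_1[OF assms(1) apath_arc[OF assms]] by simp
  moreover have "graph_dist G u v \<le> 1" using graph_dist_le_apath[OF apath_arc[OF assms]] by simp
  ultimately show ?thesis by simp
qed

lemma graph_dist_common_neighbour:
  assumes "pair_graph G" "u \<noteq> v" "(u, v) \<notin> parcs G" "(u, w) \<in> parcs G" "(w, v) \<in> parcs G"
  shows "graph_dist G u v = 2"
proof -
  interpret pair_graph G by fact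
  have p: "apath u [(u, w), (w, v)] v"
    using assms by (auto simp: apath_simps dest: wellformed' no_loops')
  have "2 \<le> graph_dist G u v" using graph_dist_ge_2[OF assms(1) p assms(2,3)] by simp
  moreover have "graph_dist G u v \<le> 2" using graph_dist_le_apath[OF p] by simp
  ultimately show ?thesis by simp
qed

lemma connected_imp_apath:
  assumes "pair_graph G" "Digraph_Component.connected (with_proj G)" "u \<in> pverts G" "v \<in> pverts G"
  shows "\<exists>p. pre_digraph.apath (with_proj G) u p v"
proof -
  interpret pair_graph G by fact
  have "strongly_connected (with_proj G)"
    using assms(2) pair_sym_arcs by (intro symmetric_connected_imp_strongly_connected)
  then have "u \<rightarrow>\<^sup>*\<^bsub>with_proj G\<^esub> v" using assms(3,4) by (auto simp: strongly_connected_def)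
  then show ?thesis using reachable_apath by auto
qed

text \<open>
For disjoint \<open>S\<close>, \<open>T\<close> with \<open>S\<close> nonempty, this is the distance in the edge-maximal graph in which \<open>S\<close>
contains all neighbours of \<open>T\<close>: any vertex of \<open>S\<close> is a common neighbour of two nonadjacent vertices.
\<close>

definition split_dist :: "'a set \<Rightarrow> 'a set \<Rightarrow> 'a \<Rightarrow> 'a \<Rightarrow> nat" where
  "split_dist S T u v =
     (if u = v then 0 else if u \<in> T \<and> v \<notin> S \<or> v \<in> T \<and> u \<notin> S then 2 else 1)"

text \<open>
Deleting edges cannot shorten distances. As the completed graph has diameter at most 2, it is enough
that distinct vertices of \<open>G\<close> have distance at least 1, and nonadjacent ones at least 2.
\<close>

lemma split_dist_le_graph_dist:
  assumes G: "pair_graph G" "Digraph_Component.connected (with_proj G)"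
    and T: "\<And>u v. (u, v) \<in> parcs G \<Longrightarrow> u \<in> T \<Longrightarrow> v \<in> S"
    and uv: "u \<in> pverts G" "v \<in> pverts G"
  shows "split_dist S T u v \<le> graph_dist G u v"
proof -
  interpret pair_graph G by fact
  obtain p where p: "apath u p v" using connected_imp_apath[OF G uv] by auto
  have "(u, v) \<notin> parcs G" if "u \<in> T \<and> v \<notin> S \<or> v \<in> T \<and> u \<notin> S"
    using that T arcs_symmetric by blast
  then show ?thesis
    using graph_dist_ge_1[OF G(1)] graph_dist_ge_2[OF G(1)] p
    by (auto simp: split_dist_def)
qed

section \<open>The largest eigenvalue of a distance matrix\<close>

definition quad_form :: "'a set \<Rightarrow> ('a \<Rightarrow> 'a \<Rightarrow> real) \<Rightarrow> ('a \<Rightarrow> real) \<Rightarrow> real" where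
  "quad_form V d x = (\<Sum>u\<in>V. \<Sum>v\<in>V. d u v * x u * x v)"

text \<open>
The unit sphere is compact. Vectors indexed by \<open>V\<close> are functions vanishing off \<open>V\<close>, so that
compactness comes from Tychonoff's theorem for \<open>[-1, 1]\<close>-valued functions and no type depends on
the size of \<open>V\<close>.
\<close>

lemma rayleigh_maximizer_exists:
  fixes d :: "'a \<Rightarrow> 'a \<Rightarrow> real"
  assumes fin: "finite V" and ne: "V \<noteq> {}"
  shows "\<exists>x. (\<Sum>v\<in>V. (x v)\<^sup>2) = 1 \<and> (\<forall>y. quad_form V d y \<le> quad_form V d x * (\<Sum>v\<in>V. (y v)\<^sup>2))"
proof -
  define F where "F v = (if v \<in> V then {-1..1} else {0::real})" for v
  define K where "K = (PiE UNIV F) \<inter> {x. (\<Sum>v\<in>V. (x v)\<^sup>2) = 1}"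
  have "compactin (product_topology (\<lambda>i. euclidean) UNIV) (PiE UNIV F)"
    by (subst compactin_PiE) (auto simp: F_def)
  then have "compact (PiE UNIV F)"
    by (simp add: euclidean_product_topology)
  moreover have "closed {x :: 'a \<Rightarrow> real. (\<Sum>v\<in>V. (x v)\<^sup>2) = 1}"
    by (intro closed_Collect_eq continuous_intros continuous_on_product_coordinates)
  ultimately have K: "compact K"
    unfolding K_def by (rule compact_Int_closed)
  obtain w where w: "w \<in> V" using ne by blast
  have "(\<lambda>v. if v = w then 1 else 0) \<in> K"
    using w fin by (auto simp: K_def F_def PiE_def Pi_def if_distrib[of "\<lambda>t. t\<^sup>2"] cong: if_cong)
  then have "K \<noteq> {}" by blast
  moreover have "continuous_on K (quad_form V d)"
    unfolding quad_form_def[abs_def]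
    by (intro continuous_intros continuous_on_subset[OF continuous_on_product_coordinates]) auto
  ultimately obtain x where x: "x \<in> K" and max: "\<And>y. y \<in> K \<Longrightarrow> quad_form V d y \<le> quad_form V d x"
    using continuous_attains_sup[OF K] by blast
  have "quad_form V d y \<le> quad_form V d x * (\<Sum>v\<in>V. (y v)\<^sup>2)" for y
  proof (cases "(\<Sum>v\<in>V. (y v)\<^sup>2) = 0")
    case True
    then have "\<forall>v\<in>V. y v = 0" using fin by (simp add: sum_nonneg_eq_0_iff)
    then show ?thesis using True by (simp add: quad_form_def)
  next
    case False
    define N where "N = (\<Sum>v\<in>V. (y v)\<^sup>2)"
    have N: "N > 0" using False by (simp add: N_def sum_nonneg less_le)
    define z where "z v = (if v \<in> V then y v / sqrt N else 0)" for v
    have z2: "(z v)\<^sup>2 = (y v)\<^sup>2 / N" if "v \<in> V" for v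
      using that N by (simp add: z_def power_divide)
    have sumz: "(\<Sum>v\<in>V. (z v)\<^sup>2) = 1"
      using N by (simp add: z2 N_def flip: sum_divide_distrib)
    have "z v \<in> F v" for v
    proof (cases "v \<in> V")
      case True
      have "(z v)\<^sup>2 \<le> (\<Sum>v\<in>V. (z v)\<^sup>2)"
        using True fin by (intro member_le_sum) auto
      then have "\<bar>z v\<bar> \<le> 1" by (simp add: sumz abs_square_le_1)
      then show ?thesis using True by (auto simp: F_def)
    qed (simp add: F_def z_def)
    then have "z \<in> K" using sumz by (simp add: K_def PiE_def Pi_def)
    have "d u v * z u * z v = d u v * y u * y v / N" if "u \<in> V" "v \<in> V" for u v
      using that N by (simp add: z_def field_simps flip: power2_eq_square)
    then have "quad_form V d z = quad_form V d y / N"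
      by (simp add: quad_form_def sum_divide_distrib)
    then show ?thesis
      using max[OF \<open>z \<in> K\<close>] N by (simp add: N_def field_simps)
  qed
  moreover have "(\<Sum>v\<in>V. (x v)\<^sup>2) = 1" using x by (simp add: K_def)
  ultimately show ?thesis by blast
qed

text \<open>
The form \<open>m |x|\<^sup>2 - d(x, x)\<close> is positive semidefinite and vanishes at \<open>x\<close>, so its gradient there
must vanish: otherwise a small step against the gradient would make it negative.
\<close>

lemma rayleigh_maximizer_eigenvector:
  assumes sym: "\<And>u v. u \<in> V \<Longrightarrow> v \<in> V \<Longrightarrow> d u v = d v u"
    and fin: "finite V"
    and max: "\<And>y. quad_form V d y \<le> m * (\<Sum>v\<in>V. (y v)\<^sup>2)"
    and eq: "quad_form V d x = m * (\<Sum>v\<in>V. (x v)\<^sup>2)"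
    and u: "u \<in> V"
  shows "(\<Sum>v\<in>V. d u v * x v) = m * x u"
proof -
  define g where "g u = (\<Sum>v\<in>V. d u v * x v) - m * x u" for u
  define a where "a = (\<Sum>u\<in>V. (g u)\<^sup>2)"
  define c where "c = quad_form V d g - m * a"
  have mixed: "(\<Sum>u\<in>V. \<Sum>v\<in>V. d u v * g u * x v) = a + m * (\<Sum>u\<in>V. g u * x u)"
  proof -
    have "(\<Sum>u\<in>V. \<Sum>v\<in>V. d u v * g u * x v) = (\<Sum>u\<in>V. g u * (\<Sum>v\<in>V. d u v * x v))"
      by (simp add: sum_distrib_left mult_ac)
    also have "\<dots> = (\<Sum>u\<in>V. g u * (g u + m * x u))"
      by (simp add: g_def)
    finally show ?thesis
      by (simp add: a_def algebra_simps power2_eq_square sum.distrib sum_distrib_left)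
  qed
  have mixed': "(\<Sum>u\<in>V. \<Sum>v\<in>V. d u v * x u * g v) = (\<Sum>u\<in>V. \<Sum>v\<in>V. d u v * g u * x v)"
    by (subst sum.swap) (auto intro!: sum.cong simp: sym)
  have le: "2 * t * a + t\<^sup>2 * c \<le> 0" for t
  proof -
    have "quad_form V d (\<lambda>v. x v + t * g v) = quad_form V d x
       + t * (\<Sum>u\<in>V. \<Sum>v\<in>V. d u v * x u * g v) + t * (\<Sum>u\<in>V. \<Sum>v\<in>V. d u v * g u * x v)
       + t\<^sup>2 * quad_form V d g"
      by (simp add: quad_form_def algebra_simps sum.distrib sum_distrib_left power2_eq_square)
    moreover have "(\<Sum>v\<in>V. (x v + t * g v)\<^sup>2) = (\<Sum>v\<in>V. (x v)\<^sup>2) + 2 * t * (\<Sum>v\<in>V. g v * x v) + t\<^sup>2 * a"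
      by (simp add: a_def algebra_simps sum.distrib sum_distrib_left power2_eq_square)
    ultimately show ?thesis
      using max[of "\<lambda>v. x v + t * g v"] unfolding mixed' mixed eq c_def
      by (simp add: algebra_simps)
  qed
  have "a = 0"
  proof (rule ccontr)
    assume "a \<noteq> 0"
    then have a: "a > 0" by (simp add: a_def sum_nonneg less_le)
    \<comment> \<open>A step this short keeps the linear term dominant over the quadratic one.\<close>
    define t where "t = a / (\<bar>c\<bar> + 1)"
    have t: "t > 0" using a by (simp add: t_def)
    have "t * \<bar>c\<bar> < 2 * a" using a by (simp add: t_def field_simps) (smt (verit) mult_nonneg_nonneg)
    moreover have "\<bar>t * c\<bar> = t * \<bar>c\<bar>" using t by (simp add: abs_mult)
    ultimately have "2 * a + t * c > 0" by linarith
    then have "t * (2 * a + t * c) > 0"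
      using t by simp
    then show False using le[of t] by (simp add: algebra_simps power2_eq_square)
  qed
  then have "g u = 0" using fin u by (simp add: a_def sum_nonneg_eq_0_iff)
  then show ?thesis by (simp add: g_def)
qed


text \<open>
Eigenvectors are transported between coordinates \<open>0, \<dots>, n - 1\<close> and functions on \<open>V\<close>, which makes
the choice of the enumeration irrelevant.
\<close>

lemma eigenvalue_enumeration_iff:
  fixes d :: "'a \<Rightarrow> 'a \<Rightarrow> real"
  assumes dist: "distinct vs" and V: "set vs = V"
  shows "eigenvalue (mat (length vs) (length vs) (\<lambda>(i, j). d (vs ! i) (vs ! j))) l \<longleftrightarrow>
    (\<exists>x. (\<exists>v\<in>V. x v \<noteq> 0) \<and> (\<forall>u\<in>V. (\<Sum>v\<in>V. d u v * x v) = l * x u))"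
    (is "eigenvalue ?A l \<longleftrightarrow> ?R")
proof -
  let ?n = "length vs"
  have bij: "bij_betw ((!) vs) {0..<?n} V"
    using bij_betw_nth[OF dist, of "{0..<?n}" V] V by (simp add: lessThan_atLeast0)
  have nth: "\<exists>i<?n. u = vs ! i" if "u \<in> V" for u
    using that V by (auto simp: in_set_conv_nth)
  have mv: "(?A *\<^sub>v w) $ i = (\<Sum>j=0..<?n. d (vs ! i) (vs ! j) * w $ j)"
    if "i < ?n" "w \<in> carrier_vec ?n" for i w
    using that by (simp add: scalar_prod_def)
  show ?thesis
  proof
    assume "eigenvalue ?A l"
    then obtain w where w: "w \<in> carrier_vec ?n" "w \<noteq> 0\<^sub>v ?n" "?A *\<^sub>v w = l \<cdot>\<^sub>v w"
      by (auto simp: eigenvalue_def eigenvector_def)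
    define x where "x v = w $ (the_inv_into {0..<?n} ((!) vs) v)" for v
    have x: "x (vs ! i) = w $ i" if "i < ?n" for i
      using that bij by (simp add: x_def the_inv_into_f_f bij_betw_def)
    obtain i where "i < ?n" "w $ i \<noteq> 0"
      using w(1,2) by (metis carrier_vecD eq_vecI index_zero_vec(1,2))
    then have "\<exists>v\<in>V. x v \<noteq> 0" using x V by (metis nth_mem)
    moreover have "(\<Sum>v\<in>V. d u v * x v) = l * x u" if "u \<in> V" for u
    proof -
      from nth[OF that] obtain i where i: "i < ?n" "u = vs ! i" by blast
      have "(\<Sum>v\<in>V. d u v * x v) = (\<Sum>j=0..<?n. d u (vs ! j) * x (vs ! j))"
        by (rule sum.reindex_bij_betw[OF bij, symmetric])
      also have "\<dots> = (?A *\<^sub>v w) $ i"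
        using i w(1) by (subst mv) (simp_all add: x)
      also have "\<dots> = l * x u" using i w by (simp add: x)
      finally show ?thesis .
    qed
    ultimately show ?R by blast
  next
    assume ?R
    then obtain x where x: "\<exists>v\<in>V. x v \<noteq> 0"
      "\<And>u. u \<in> V \<Longrightarrow> (\<Sum>v\<in>V. d u v * x v) = l * x u" by blast
    define w where "w = vec ?n (\<lambda>i. x (vs ! i))"
    have w: "w \<in> carrier_vec ?n" by (simp add: w_def)
    obtain i where i: "i < ?n" "x (vs ! i) \<noteq> 0" using x(1) nth by blast
    then have "w $ i \<noteq> 0\<^sub>v ?n $ i" by (simp add: w_def)
    then have "w \<noteq> 0\<^sub>v ?n" by metis
    moreover have "?A *\<^sub>v w = l \<cdot>\<^sub>v w"
    proof (rule eq_vecI)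
      fix i assume "i < dim_vec (l \<cdot>\<^sub>v w)"
      then have i: "i < ?n" by (simp add: w_def)
      have "(?A *\<^sub>v w) $ i = (\<Sum>j=0..<?n. d (vs ! i) (vs ! j) * x (vs ! j))"
        using i w by (subst mv) (simp_all add: w_def)
      also have "\<dots> = (\<Sum>v\<in>V. d (vs ! i) v * x v)"
        by (rule sum.reindex_bij_betw[OF bij])
      also have "\<dots> = l * x (vs ! i)" using i V by (intro x(2)) auto
      finally show "(?A *\<^sub>v w) $ i = (l \<cdot>\<^sub>v w) $ i" using i by (simp add: w_def)
    qed (simp add: w_def)
    ultimately show "eigenvalue ?A l"
      using w unfolding eigenvalue_def eigenvector_def by (intro exI[of _ w]) auto
  qed
qed

text \<open>
The Rayleigh characterization of the distance spectral radius, together with the part of the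
Perron-Frobenius theorem used here. Distances are nonnegative, so replacing a maximizer of the
Rayleigh quotient by its absolute value does not decrease the form; the absolute value is again a
maximizer, hence an eigenvector. Its eigenvalue bounds all others, as each is a value of the
Rayleigh quotient.
\<close>

lemma distance_spectral_radius_perron:
  fixes G :: "'a pair_pre_digraph"
  defines "V \<equiv> pverts G" and "d \<equiv> (\<lambda>u v. real (graph_dist G u v))"
    and "m \<equiv> distance_spectral_radius G"
  assumes fin: "finite V" and ne: "V \<noteq> {}"
    and sym: "\<And>u v. u \<in> V \<Longrightarrow> v \<in> V \<Longrightarrow> d u v = d v u"
  shows "\<And>y. quad_form V d y \<le> m * (\<Sum>v\<in>V. (y v)\<^sup>2)"
    and "\<exists>x. (\<forall>v\<in>V. x v \<ge> 0) \<and> (\<Sum>v\<in>V. (x v)\<^sup>2) = 1 \<and>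
           (\<forall>u\<in>V. (\<Sum>v\<in>V. d u v * x v) = m * x u)"
proof -
  define vs where "vs = (SOME vs. distinct vs \<and> set vs = pverts G)"
  have "\<exists>vs. distinct vs \<and> set vs = pverts G"
    using fin finite_distinct_list unfolding V_def by blast
  then have vs: "distinct vs" "set vs = V"
    unfolding vs_def V_def by (metis (mono_tags, lifting) someI_ex)+
  define A where "A = mat (length vs) (length vs) (\<lambda>(i, j). d (vs ! i) (vs ! j))"
  have m: "m = Max (spectrum A)"
    by (simp add: m_def distance_spectral_radius_def distance_matrix_def A_def d_def vs_def)
  obtain x0 where x0: "(\<Sum>v\<in>V. (x0 v)\<^sup>2) = 1"
    "\<And>y. quad_form V d y \<le> quad_form V d x0 * (\<Sum>v\<in>V. (y v)\<^sup>2)"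
    using rayleigh_maximizer_exists[OF fin ne, of d] by blast
  define q where "q = quad_form V d x0"
  define x where "x v = \<bar>x0 v\<bar>" for v
  have x1: "(\<Sum>v\<in>V. (x v)\<^sup>2) = 1" by (simp add: x_def x0)
  have "q \<le> quad_form V d x"
    unfolding q_def quad_form_def
  proof (intro sum_mono)
    fix u v
    have "x0 u * x0 v \<le> x u * x v" by (simp add: x_def flip: abs_mult)
    then have "d u v * (x0 u * x0 v) \<le> d u v * (x u * x v)"
      by (rule mult_left_mono) (simp add: d_def)
    then show "d u v * x0 u * x0 v \<le> d u v * x u * x v" by (simp add: mult.assoc)
  qed
  moreover have "quad_form V d x \<le> q" using x0(2)[of x] by (simp add: x1 q_def)
  ultimately have qx: "quad_form V d x = q * (\<Sum>v\<in>V. (x v)\<^sup>2)" by (simp add: x1)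
  have q: "quad_form V d y \<le> q * (\<Sum>v\<in>V. (y v)\<^sup>2)" for y
    using x0(2) by (simp add: q_def)
  have eig: "(\<Sum>v\<in>V. d u v * x v) = q * x u" if "u \<in> V" for u
    by (rule rayleigh_maximizer_eigenvector[OF sym fin q qx that])
  have "\<exists>v\<in>V. x v \<noteq> 0"
  proof (rule ccontr)
    assume "\<not> (\<exists>v\<in>V. x v \<noteq> 0)"
    then have "(\<Sum>v\<in>V. (x v)\<^sup>2) = 0" by simp
    then show False using x1 by simp
  qed
  then have "q \<in> spectrum A"
    unfolding spectrum_def A_def using eig eigenvalue_enumeration_iff[OF vs, of d q] by auto
  moreover have "l \<le> q" if "l \<in> spectrum A" for l
  proof -
    have "eigenvalue A l" using that by (simp add: spectrum_def)
    then obtain y where y: "\<exists>v\<in>V. y v \<noteq> 0" "\<And>u. u \<in> V \<Longrightarrow> (\<Sum>v\<in>V. d u v * y v) = l * y u"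
      unfolding A_def eigenvalue_enumeration_iff[OF vs, of d l] by blast
    have "quad_form V d y = (\<Sum>u\<in>V. y u * (\<Sum>v\<in>V. d u v * y v))"
      by (simp add: quad_form_def sum_distrib_left mult_ac)
    also have "\<dots> = (\<Sum>u\<in>V. y u * (l * y u))"
      using y(2) by simp
    also have "\<dots> = l * (\<Sum>v\<in>V. (y v)\<^sup>2)"
      by (simp add: sum_distrib_left power2_eq_square mult_ac)
    finally have "l * (\<Sum>v\<in>V. (y v)\<^sup>2) \<le> q * (\<Sum>v\<in>V. (y v)\<^sup>2)" using q[of y] by simp
    moreover have "(\<Sum>v\<in>V. (y v)\<^sup>2) > 0"
      using y(1) fin by (meson sum_pos2 zero_le_power2 zero_less_power2)
    ultimately show "l \<le> q" by simp
  qed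
  moreover have "finite (spectrum A)"
    by (rule card_finite_spectrum(1)[of _ "length vs"]) (simp add: A_def)
  ultimately have mq: "m = q" unfolding m by (intro Max_eqI) auto
  show "quad_form V d y \<le> m * (\<Sum>v\<in>V. (y v)\<^sup>2)" for y using q mq by simp
  show "\<exists>x. (\<forall>v\<in>V. x v \<ge> 0) \<and> (\<Sum>v\<in>V. (x v)\<^sup>2) = 1 \<and>
           (\<forall>u\<in>V. (\<Sum>v\<in>V. d u v * x v) = m * x u)"
    using eig mq x1 by (intro exI[of _ x]) (auto simp: x_def)
qed

section \<open>Hall's theorem and fractional perfect matchings\<close>

text \<open>
The induction of Halmos and Vaughan. If some nonempty proper subset \<open>X\<close> is tight, meaning that it has
no more neighbours than elements, match \<open>X\<close> first and then the rest avoiding the neighbours of \<open>X\<close>;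
otherwise there is room to match any one element arbitrarily.
\<close>

theorem hall_marriage:
  fixes N :: "'a \<Rightarrow> 'b set"
  assumes "finite A" and "\<And>a. a \<in> A \<Longrightarrow> finite (N a)"
    and "\<And>X. X \<subseteq> A \<Longrightarrow> card X \<le> card (\<Union>(N ` X))"
  shows "\<exists>f. inj_on f A \<and> (\<forall>a\<in>A. f a \<in> N a)"
  using assms
proof (induction A arbitrary: N rule: finite_psubset_induct)
  case (psubset A)
  note finN = psubset.prems(1) and hall = psubset.prems(2)
  have finU: "finite (\<Union>(N ` X))" if "X \<subseteq> A" for X
    using that finN psubset.hyps finite_subset by blast
  show ?case
  proof (cases "A = {}")
    case False
    then obtain a where a: "a \<in> A" by blast
    show ?thesis
    proof (cases "\<exists>X. X \<subset> A \<and> X \<noteq> {} \<and> card (\<Union>(N ` X)) \<le> card X")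
      case True
      then obtain X where X: "X \<subset> A" "X \<noteq> {}" "card (\<Union>(N ` X)) \<le> card X" by blast
      have finX: "finite X" using X(1) psubset.hyps finite_subset by blast
      have "\<exists>f. inj_on f X \<and> (\<forall>a\<in>X. f a \<in> N a)"
        using X(1) by (intro psubset.IH finN hall) auto
      then obtain f where f: "inj_on f X" "\<And>a. a \<in> X \<Longrightarrow> f a \<in> N a" by blast
      define N' where "N' a = N a - \<Union>(N ` X)" for a
      have "\<exists>g. inj_on g (A - X) \<and> (\<forall>a\<in>A - X. g a \<in> N' a)"
      proof (rule psubset.IH)
        show "A - X \<subset> A" using X by blast
        show "finite (N' a)" if "a \<in> A - X" for a using that finN by (simp add: N'_def)
        fix Y assume Y: "Y \<subseteq> A - X"
        have "card Y + card X = card (Y \<union> X)"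
          using Y finX psubset.hyps by (subst card_Un_disjoint) (auto intro: finite_subset)
        also have "\<dots> \<le> card (\<Union>(N ` (Y \<union> X)))" using Y X(1) by (intro hall) auto
        also have "\<Union>(N ` (Y \<union> X)) = \<Union>(N' ` Y) \<union> \<Union>(N ` X)" by (auto simp: N'_def)
        also have "card \<dots> \<le> card (\<Union>(N' ` Y)) + card (\<Union>(N ` X))" by (rule card_Un_le)
        finally show "card Y \<le> card (\<Union>(N' ` Y))" using X(3) by simp
      qed
      then obtain g where g: "inj_on g (A - X)" "\<And>a. a \<in> A - X \<Longrightarrow> g a \<in> N' a" by blast
      define h where "h a = (if a \<in> X then f a else g a)" for a
      have "h a \<noteq> h b" if "a \<in> X" "b \<in> A - X" for a b
        using f(2)[of a] g(2)[of b] that by (auto simp: h_def N'_def)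
      then have "inj_on h A"
        using f(1) g(1) by (auto simp: inj_on_def h_def) metis+
      moreover have "\<forall>a\<in>A. h a \<in> N a" using f(2) g(2) by (auto simp: h_def N'_def)
      ultimately show ?thesis by blast
    next
      case tight: False
      have "card {a} \<le> card (\<Union>(N ` {a}))" using a by (intro hall) simp
      then obtain b where b: "b \<in> N a" by (cases "N a = {}") auto
      define N' where "N' x = N x - {b}" for x
      have "\<exists>f. inj_on f (A - {a}) \<and> (\<forall>x\<in>A - {a}. f x \<in> N' x)"
      proof (rule psubset.IH)
        show "A - {a} \<subset> A" using a by blast
        show "finite (N' x)" if "x \<in> A - {a}" for x using that finN by (simp add: N'_def)
        fix X assume X: "X \<subseteq> A - {a}"
        show "card X \<le> card (\<Union>(N' ` X))"
        proof (cases "X = {}")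
          case False
          moreover have "X \<subset> A" using X a by blast
          ultimately have "card X < card (\<Union>(N ` X))" using tight not_le by blast
          moreover have "\<Union>(N' ` X) = \<Union>(N ` X) - {b}" by (auto simp: N'_def)
          ultimately show ?thesis using finU[of X] X
            by (cases "b \<in> \<Union>(N ` X)") (auto simp: card_Diff_singleton)
        qed simp
      qed
      then obtain f where f: "inj_on f (A - {a})" "\<And>x. x \<in> A - {a} \<Longrightarrow> f x \<in> N' x" by blast
      have "inj_on (f(a := b)) A"
        using f by (auto simp: inj_on_def N'_def)
      moreover have "\<forall>x\<in>A. (f(a := b)) x \<in> N x" using f(2) b by (auto simp: N'_def)
      ultimately show ?thesis by blast
    qed
  qed simp
qed

text \<open>
Hall's theorem applied to two copies of \<open>W\<close> joined by \<open>R\<close>. If a set \<open>X\<close> violates Hall's condition and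
\<open>Y\<close> denotes its neighbours, then \<open>X \<inter> Y\<close> can be cancelled on both sides: by symmetry of \<open>R\<close>, no
element of \<open>X - Y\<close> has a neighbour in \<open>X\<close>, so \<open>X - Y\<close> is an independent set with all its
neighbours in the smaller set \<open>Y - X\<close>.
\<close>

lemma permutation_along_relation_or_deficient_set:
  assumes fin: "finite W" and sym: "sym R"
  obtains (permutation) f where "bij_betw f W W" "\<And>v. v \<in> W \<Longrightarrow> (v, f v) \<in> R"
  | (deficient) S I where "S \<subseteq> W" "I \<subseteq> W" "S \<inter> I = {}" "card S < card I"
      "\<And>u w. u \<in> I \<Longrightarrow> w \<in> W \<Longrightarrow> (u, w) \<in> R \<Longrightarrow> w \<in> S"
proof -
  define N where "N u = {w \<in> W. (u, w) \<in> R}" for u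
  show thesis
  proof (cases "\<forall>X\<subseteq>W. card X \<le> card (\<Union>(N ` X))")
    case True
    then have "\<exists>f. inj_on f W \<and> (\<forall>v\<in>W. f v \<in> N v)"
      using fin by (intro hall_marriage) (auto simp: N_def)
    then obtain f where f: "inj_on f W" "\<And>v. v \<in> W \<Longrightarrow> f v \<in> N v" by blast
    then have "f ` W \<subseteq> W" by (auto simp: N_def)
    then have "f ` W = W" using endo_inj_surj[OF fin _ f(1)] by blast
    then show thesis using f by (intro permutation[of f]) (auto simp: bij_betw_def N_def)
  next
    case False
    then obtain X where X: "X \<subseteq> W" "card (\<Union>(N ` X)) < card X" by auto
    define Y where "Y = \<Union>(N ` X)"
    have YW: "Y \<subseteq> W" by (auto simp: Y_def N_def)
    have finXY: "finite X" "finite Y" using X(1) YW fin finite_subset by auto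
    have "card (Y - X) + card (X \<inter> Y) = card Y"
      using finXY by (metis Int_commute add.commute card_Int_Diff)
    moreover have "card (X - Y) + card (X \<inter> Y) = card X"
      using finXY by (metis add.commute card_Int_Diff)
    ultimately have smaller: "card (Y - X) < card (X - Y)" using X(2) by (simp add: Y_def)
    have nb: "w \<in> Y - X" if u: "u \<in> X - Y" and w: "w \<in> W" and uw: "(u, w) \<in> R" for u w
    proof -
      have "w \<in> Y" using u w uw by (auto simp: Y_def N_def)
      moreover have "w \<notin> X"
      proof
        assume "w \<in> X"
        then have "u \<in> Y" using u uw X(1) sym by (auto simp: Y_def N_def dest: symD)
        then show False using u by blast
      qed
      ultimately show ?thesis by blast
    qed
    show thesis
      by (rule deficient[of "Y - X" "X - Y", OF _ _ _ smaller nb]) (use X(1) YW in auto)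
  qed
qed

lemma card_Union_k_matching:
  assumes "pair_graph G" "k_matching G k M"
  shows "card (\<Union>M) = 2 * k" "\<Union>M \<subseteq> pverts G" "finite (\<Union>M)"
proof -
  interpret pair_graph G by fact
  have M: "M \<subseteq> edges G" "finite M" "card M = k" "pairwise disjnt M"
    using assms(2) by (auto simp: k_matching_def)
  have e: "card e = 2 \<and> finite e \<and> e \<subseteq> pverts G" if "e \<in> M" for e
  proof -
    have "e \<in> edges G" using that M(1) by blast
    then show ?thesis by (auto simp: edges_def card_insert_if dest: no_loops' wellformed')
  qed
  have "card (\<Union>M) = (\<Sum>e\<in>M. card e)"
    using M(2,4) e by (intro card_Union_disjoint) (auto simp: pairwise_def)
  then show "card (\<Union>M) = 2 * k" using e M(3) by simp
  show "\<Union>M \<subseteq> pverts G" "finite (\<Union>M)" using e M(2) by auto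
qed

text \<open>
Away from the edges of \<open>M\<close>, the cycles of \<open>f\<close> carry the matching: each arc \<open>(u, f u)\<close> contributes
weight 1/2 to its edge, and every vertex is the start of one arc and the end of another. A 2-cycle of
\<open>f\<close> gives its edge weight 1.
\<close>

lemma fractional_perfect_matching_of_permutation:
  assumes G: "pair_graph G" and M: "k_matching G k M"
    and f: "bij_betw f (pverts G - \<Union>M) (pverts G - \<Union>M)"
    and adj: "\<And>v. v \<in> pverts G - \<Union>M \<Longrightarrow> (v, f v) \<in> parcs G"
  shows "\<exists>h. fractional_perfect_matching G h \<and> (\<forall>e\<in>M. h e = 1)"
proof -
  interpret pair_graph G by fact
  define W where "W = pverts G - \<Union>M"
  have finW: "finite W" using pair_finite_verts by (simp add: W_def)
  have M': "M \<subseteq> edges G" "pairwise disjnt M" using M by (auto simp: k_matching_def)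
  have fW: "f v \<in> W" if "v \<in> W" for v using f that by (auto simp: W_def bij_betw_def)
  have fne: "f v \<noteq> v" if "v \<in> W" for v using adj[of v] that by (auto simp: W_def dest: no_loops')
  have edge: "{v, f v} \<in> edges G" if "v \<in> W" for v
    using adj[of v] that by (auto simp: W_def edges_def)
  have notM: "{v, f v} \<notin> M" if "v \<in> W" for v using that by (auto simp: W_def)
  have finE: "finite (edges G)"
  proof -
    have "edges G = (\<lambda>(u, v). {u, v}) ` parcs G" by (auto simp: edges_def)
    then show ?thesis using pair_finite_arcs by simp
  qed
  define h :: "'a set \<Rightarrow> real" where
    "h e = (if e \<in> M then 1 else real (card {u \<in> W. {u, f u} = e}) / 2)" for e
  have "0 \<le> h e \<and> h e \<le> 1" if "e \<in> edges G" for e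
  proof -
    have e: "finite e" "card e \<le> 2" using that by (auto simp: edges_def card_insert_if)
    have "card {u \<in> W. {u, f u} = e} \<le> card e" using e by (intro card_mono) auto
    then show ?thesis using e by (simp add: h_def)
  qed
  moreover have "(\<Sum>e\<in>{e \<in> edges G. v \<in> e}. h e) = 1" if v: "v \<in> pverts G" for v
  proof (cases "v \<in> \<Union>M")
    case True
    then obtain e where e: "e \<in> M" "v \<in> e" by blast
    have "h e' = 0" if "e' \<in> {e \<in> edges G. v \<in> e} - {e}" for e'
    proof -
      have "e' \<notin> M" using that e M'(2) by (auto simp: pairwise_def disjnt_iff)
      moreover have "{u \<in> W. {u, f u} = e'} = {}"
        using that e fW by (auto simp: W_def)
      then have "card {u \<in> W. {u, f u} = e'} = 0" by (simp only: card.empty)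
      ultimately show ?thesis by (simp add: h_def)
    qed
    then have "(\<Sum>e\<in>{e \<in> edges G. v \<in> e}. h e) = (\<Sum>e\<in>{e}. h e)"
      using finE e M'(1) by (intro sum.mono_neutral_right) auto
    then show ?thesis using e by (simp add: h_def)
  next
    case False
    then have vW: "v \<in> W" using v by (simp add: W_def)
    have "v \<in> f ` W" using f vW by (simp add: W_def bij_betw_def)
    then obtain w where w: "w \<in> W" "f w = v" by blast
    have "w \<noteq> v" using fne[OF w(1)] w(2) by auto
    have star: "{u \<in> W. v \<in> {u, f u}} = {v, w}"
      using vW w f by (auto simp: W_def bij_betw_def inj_on_def)
    have "(\<Sum>e\<in>{e \<in> edges G. v \<in> e}. card {u \<in> W. {u, f u} = e}) =
        card (\<Union>e\<in>{e \<in> edges G. v \<in> e}. {u \<in> W. {u, f u} = e})"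
      using finE finW by (intro card_UN_disjoint[symmetric]) auto
    also have "(\<Union>e\<in>{e \<in> edges G. v \<in> e}. {u \<in> W. {u, f u} = e}) = {u \<in> W. v \<in> {u, f u}}"
      using edge by blast
    finally have "(\<Sum>e\<in>{e \<in> edges G. v \<in> e}. card {u \<in> W. {u, f u} = e}) = 2"
      using star \<open>w \<noteq> v\<close> by simp
    then have "real (\<Sum>e\<in>{e \<in> edges G. v \<in> e}. card {u \<in> W. {u, f u} = e}) = 2"
      by (simp only: of_nat_numeral)
    then have "(\<Sum>e\<in>{e \<in> edges G. v \<in> e}. real (card {u \<in> W. {u, f u} = e})) = 2"
      by (simp only: of_nat_sum)
    moreover have "(\<Sum>e\<in>{e \<in> edges G. v \<in> e}. h e) =
        (\<Sum>e\<in>{e \<in> edges G. v \<in> e}. real (card {u \<in> W. {u, f u} = e}) / 2)"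
      using False by (intro sum.cong) (auto simp: h_def)
    ultimately show ?thesis by (simp only: sum_divide_distrib[symmetric])
  qed
  ultimately have "fractional_perfect_matching G h"
    by (simp add: fractional_perfect_matching_def)
  then show ?thesis by (intro exI[of _ h]) (simp add: h_def)
qed

lemma min_degree_le_card_neighbours:
  assumes "pair_graph G" "v \<in> pverts G"
  shows "min_degree G \<le> card {w. (v, w) \<in> parcs G}"
proof -
  interpret pair_graph G by fact
  have "min_degree G \<le> out_degree (with_proj G) v"
    using assms(2) pair_finite_verts unfolding min_degree_def by (intro Min_le) auto
  also have "\<dots> = card (Pair v ` {w. (v, w) \<in> parcs G})"
    unfolding out_degree_def out_arcs_def by (rule arg_cong[where f = card]) auto
  also have "\<dots> = card {w. (v, w) \<in> parcs G}"
    by (intro card_image) (auto simp: inj_on_def)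
  finally show ?thesis .
qed

text \<open>
Greedy choice: while fewer than \<open>k\<close> edges are chosen, they cover fewer than \<open>2k\<close> vertices, hence miss
a vertex and one of its neighbours.
\<close>

lemma k_matching_exists:
  assumes G: "pair_graph G" and "2 * k \<le> min_degree G" "2 * k \<le> card (pverts G)"
  shows "\<exists>M. k_matching G k M"
  using assms(2,3)
proof (induction k)
  case 0
  then show ?case by (intro exI[of _ "{}"]) (simp add: k_matching_def)
next
  case (Suc k)
  interpret pair_graph G by fact
  obtain M where M: "k_matching G k M" using Suc by auto
  note U = card_Union_k_matching[OF G M]
  have "\<not> pverts G \<subseteq> \<Union>M"
    using Suc.prems(2) card_mono[OF U(3), of "pverts G"] U(1) by auto
  then obtain v where v: "v \<in> pverts G" "v \<notin> \<Union>M" by blast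
  have "\<not> {w. (v, w) \<in> parcs G} \<subseteq> \<Union>M"
    using Suc.prems(1) card_mono[OF U(3), of "{w. (v, w) \<in> parcs G}"] U(1)
      min_degree_le_card_neighbours[OF G v(1)] by auto
  then obtain w where w: "(v, w) \<in> parcs G" "w \<notin> \<Union>M" by blast
  have "{v, w} \<notin> M" using v by blast
  moreover have "{v, w} \<in> edges G" using w(1) by (auto simp: edges_def)
  moreover have "disjnt {v, w} e" "disjnt e {v, w}" if "e \<in> M" for e
    using that v(2) w(2) by (auto simp: disjnt_iff)
  ultimately have "k_matching G (Suc k) (insert {v, w} M)"
    using M by (simp add: k_matching_def pairwise_insert)
  then show ?case by blast
qed

text \<open>
A matching \<open>M\<close> without extension gives a deficient pair in \<open>G - \<Union>M\<close>; the \<open>2k\<close> vertices of \<open>M\<close> are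
added to its separator. The independent side is cut down to the exact size \<open>|S| - 2k + 1\<close>, which
makes the pair comparable with the extremal graph and depend on the one parameter \<open>|S|\<close>.
\<close>

lemma not_fractional_extendable_imp_split:
  assumes G: "pair_graph G" and n: "2 * k + 2 \<le> card (pverts G)" "2 * k \<le> min_degree G"
    and not_ext: "\<not> fractional_extendable k G"
  shows "\<exists>S T. S \<subseteq> pverts G \<and> T \<subseteq> pverts G \<and> S \<inter> T = {} \<and> card T + 2 * k = card S + 1 \<and>
    min_degree G \<le> card S \<and> (\<forall>u v. (u, v) \<in> parcs G \<longrightarrow> u \<in> T \<longrightarrow> v \<in> S)"
proof -
  interpret pair_graph G by fact
  obtain M where M: "k_matching G k M"
    and no: "\<not> (\<exists>h. fractional_perfect_matching G h \<and> (\<forall>e \<in> M. h e = 1))"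
    using not_ext n k_matching_exists[OF G, of k] unfolding fractional_extendable_def by auto
  note U = card_Union_k_matching[OF G M]
  have "finite (pverts G - \<Union>M)" "sym (parcs G)"
    using pair_finite_verts pair_sym_arcs by (auto simp: symmetric_def)
  then show ?thesis
  proof (cases rule: permutation_along_relation_or_deficient_set)
    case (permutation f)
    then show ?thesis using no fractional_perfect_matching_of_permutation[OF G M] by blast
  next
    case (deficient S I)
    define S' where "S' = S \<union> \<Union>M"
    have fin: "finite S" using deficient(1) pair_finite_verts finite_subset by blast
    have cardS': "card S' = card S + 2 * k"
      using fin U deficient(1) unfolding S'_def by (subst card_Un_disjoint) auto
    obtain T where T: "T \<subseteq> I" "card T = card S + 1" "finite T"
      using obtain_subset_with_card_n[of "card S + 1" I] deficient(4) by auto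
    have nb: "w \<in> S'" if "(u, w) \<in> parcs G" "u \<in> T" for u w
      using that T(1) deficient(5) wellformed' by (auto simp: S'_def)
    obtain t where t: "t \<in> T" using T(2) by fastforce
    have tV: "t \<in> pverts G" using t T(1) deficient(2) by blast
    have "min_degree G \<le> card {w. (t, w) \<in> parcs G}" by (rule min_degree_le_card_neighbours[OF G tV])
    also have "\<dots> \<le> card S'" using nb t fin U(3) by (intro card_mono) (auto simp: S'_def)
    finally have "min_degree G \<le> card S'" .
    moreover have "S' \<subseteq> pverts G" "T \<subseteq> pverts G" "S' \<inter> T = {}"
      using deficient(1,2,3) T(1) U(2) by (auto simp: S'_def)
    ultimately show ?thesis using cardS' T(2) nb by (intro exI[of _ S'] exI[of _ T]) auto
  qed
qed

section \<open>The distance form of a split graph\<close>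

text \<open>
Row sums of the matrix: each row is 1 off the diagonal, with a further 1 at every position of a
nonadjacent pair.
\<close>

lemma split_dist_sum:
  fixes x :: "'a \<Rightarrow> real"
  assumes fin: "finite V" and ST: "S \<subseteq> V" "T \<subseteq> V" "S \<inter> T = {}" and u: "u \<in> V"
  shows "(\<Sum>v\<in>V. real (split_dist S T u v) * x v) = sum x V - x u +
    (if u \<in> T then sum x T - x u + sum x (V - S - T) else if u \<in> S then 0 else sum x T)"
proof -
  let ?C = "V - S - T"
  have C: "V \<inter> ?C = ?C" by blast
  have "real (split_dist S T u v) * x v = x v - (if v = u then x v else 0) +
      (if u \<in> T then (if v \<in> T then x v else 0) - (if v = u then x v else 0) + (if v \<in> ?C then x v else 0)
       else if u \<in> S then 0 else (if v \<in> T then x v else 0))" if "v \<in> V" for v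
    using that ST u
    by (cases "u \<in> T"; cases "u \<in> S"; cases "v = u"; cases "v \<in> T"; cases "v \<in> S")
       (auto simp: split_dist_def)
  then have "(\<Sum>v\<in>V. real (split_dist S T u v) * x v) = (\<Sum>v\<in>V. x v - (if v = u then x v else 0) +
      (if u \<in> T then (if v \<in> T then x v else 0) - (if v = u then x v else 0) + (if v \<in> ?C then x v else 0)
       else if u \<in> S then 0 else (if v \<in> T then x v else 0)))"
    by (intro sum.cong refl)
  moreover have "(\<Sum>v\<in>V. if v \<in> T then x v else 0) = sum x T"
    using ST by (simp add: sum.inter_restrict[OF fin, symmetric] Int_absorb1)
  moreover have "(\<Sum>v\<in>V. if v \<in> ?C then x v else 0) = sum x ?C"
    using sum.inter_restrict[OF fin, of x ?C] C by (simp only:)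
  moreover have "(\<Sum>v\<in>V. if v = u then x v else 0) = x u"
    using fin u by simp
  ultimately show ?thesis
    by (simp add: sum.distrib sum_subtractf del: Diff_iff)
qed

lemma quad_form_split_dist:
  fixes x :: "'a \<Rightarrow> real"
  assumes fin: "finite V" and ST: "S \<subseteq> V" "T \<subseteq> V" "S \<inter> T = {}"
  shows "quad_form V (\<lambda>u v. real (split_dist S T u v)) x =
    (sum x V)\<^sup>2 - (\<Sum>v\<in>V. (x v)\<^sup>2) + (sum x T)\<^sup>2 - (\<Sum>v\<in>T. (x v)\<^sup>2) + 2 * sum x T * sum x (V - S - T)"
proof -
  let ?C = "V - S - T"
  have C: "V \<inter> ?C = ?C" and T: "V \<inter> T = T" using ST by blast+
  have "quad_form V (\<lambda>u v. real (split_dist S T u v)) x =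
      (\<Sum>u\<in>V. x u * (\<Sum>v\<in>V. real (split_dist S T u v) * x v))"
    by (simp add: quad_form_def sum_distrib_left mult_ac)
  also have "\<dots> = (\<Sum>u\<in>V. x u * (sum x V - x u) +
      ((if u \<in> T then x u * (sum x T - x u + sum x ?C) else 0) + (if u \<in> ?C then x u * sum x T else 0)))"
  proof (intro sum.cong refl)
    fix u assume u: "u \<in> V"
    show "x u * (\<Sum>v\<in>V. real (split_dist S T u v) * x v) = x u * (sum x V - x u) +
      ((if u \<in> T then x u * (sum x T - x u + sum x ?C) else 0) + (if u \<in> ?C then x u * sum x T else 0))"
      unfolding split_dist_sum[OF fin ST u] using ST u by (auto simp: algebra_simps)
  qed
  also have "\<dots> = (\<Sum>u\<in>V. x u * (sum x V - x u)) + (\<Sum>u\<in>T. x u * (sum x T - x u + sum x ?C))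
      + (\<Sum>u\<in>?C. x u * sum x T)"
    unfolding sum.distrib sum.inter_restrict[OF fin, symmetric] C T add.assoc ..
  also have "\<dots> = (sum x V)\<^sup>2 - (\<Sum>v\<in>V. (x v)\<^sup>2) + (sum x T)\<^sup>2 - (\<Sum>v\<in>T. (x v)\<^sup>2)
      + 2 * sum x T * sum x ?C"
    by (simp add: algebra_simps sum.distrib sum_subtractf power2_eq_square
        sum_distrib_left[symmetric] sum_distrib_right[symmetric])
  finally show ?thesis .
qed

definition block_vector :: "'a set \<Rightarrow> 'a set \<Rightarrow> real \<Rightarrow> real \<Rightarrow> real \<Rightarrow> 'a \<Rightarrow> real" where
  "block_vector S T a b c v = (if v \<in> S then a else if v \<in> T then c else b)"

lemma card_Un3:
  assumes "finite A" "finite B" "finite C" "A \<inter> B = {}" "A \<inter> C = {}" "B \<inter> C = {}"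
  shows "card (A \<union> (B \<union> C)) = card A + (card B + card C)"
proof -
  have "card (B \<union> C) = card B + card C" using assms by (intro card_Un_disjoint)
  moreover have "card (A \<union> (B \<union> C)) = card A + card (B \<union> C)"
    using assms by (intro card_Un_disjoint) auto
  ultimately show ?thesis by simp
qed

lemma sum_Un3:
  fixes g :: "'a \<Rightarrow> real"
  assumes "finite A" "finite B" "finite C" "A \<inter> B = {}" "A \<inter> C = {}" "B \<inter> C = {}"
  shows "sum g (A \<union> (B \<union> C)) = sum g A + (sum g B + sum g C)"
proof -
  have "sum g (B \<union> C) = sum g B + sum g C" using assms by (intro sum.union_disjoint)
  moreover have "sum g (A \<union> (B \<union> C)) = sum g A + sum g (B \<union> C)"
    using assms by (intro sum.union_disjoint) auto
  ultimately show ?thesis by simp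
qed

lemma sum_block_vector:
  assumes "finite V" "S \<subseteq> V" "T \<subseteq> V" "S \<inter> T = {}"
  shows "(\<Sum>v\<in>V. f (block_vector S T a b c v)) = 
    real (card S) * f a + real (card T) * f c + (real (card V) - real (card S) - real (card T)) * f b"
proof -
  have fin: "finite S" "finite T" using assms(1-3) by (auto intro: finite_subset)
  have V: "V = S \<union> (T \<union> (V - S - T))" using assms by blast
  have "(\<Sum>v\<in>V. f (block_vector S T a b c v)) = (\<Sum>v\<in>S. f (block_vector S T a b c v))
     + ((\<Sum>v\<in>T. f (block_vector S T a b c v)) + (\<Sum>v\<in>V - S - T. f (block_vector S T a b c v)))"
    by (subst V, rule sum_Un3[OF fin]) (use assms in auto)
  moreover have "(\<Sum>v\<in>S. f (block_vector S T a b c v)) = (\<Sum>v\<in>S. f a)"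
    by (intro sum.cong) (auto simp: block_vector_def)
  moreover have "(\<Sum>v\<in>T. f (block_vector S T a b c v)) = (\<Sum>v\<in>T. f c)"
    using assms by (intro sum.cong) (auto simp: block_vector_def)
  moreover have "(\<Sum>v\<in>V - S - T. f (block_vector S T a b c v)) = (\<Sum>v\<in>V - S - T. f b)"
    by (intro sum.cong) (auto simp: block_vector_def)
  moreover have "real (card (V - S - T)) = real (card V) - real (card S) - real (card T)"
  proof -
    have "card V = card S + (card T + card (V - S - T))"
      by (subst V, rule card_Un3[OF fin]) (use assms in auto)
    then show ?thesis by simp
  qed
  ultimately show ?thesis by simp
qed

text \<open>
The value of the quadratic form of \<open>split_dist S T\<close> on \<open>n\<close> vertices at a vector with \<open>a\<close> on \<open>s\<close>
vertices of \<open>S\<close>, \<open>c\<close> on \<open>t\<close> vertices of \<open>T\<close> and \<open>b\<close> elsewhere, where \<open>S\<close> and \<open>T\<close> each contain \<open>r\<close>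
further vertices. The parameter \<open>r\<close> enters only through the terms that count nonadjacent pairs.
\<close>

definition block_form ::
  "real \<Rightarrow> real \<Rightarrow> real \<Rightarrow> real \<Rightarrow> real \<Rightarrow> real \<Rightarrow> real \<Rightarrow> real" where
  "block_form n s t r a b c =
     (s * a + t * c + (n - s - t) * b)\<^sup>2 - (s * a\<^sup>2 + t * c\<^sup>2 + (n - s - t) * b\<^sup>2)
     + (t * c + r * b)\<^sup>2 - (t * c\<^sup>2 + r * b\<^sup>2) + 2 * (t * c + r * b) * ((n - s - t - 2 * r) * b)"

lemma quad_form_block_vector:
  fixes a b c :: real
  assumes fin: "finite V" and ST: "S \<subseteq> V" "T \<subseteq> V" "S \<inter> T = {}"
    and sub: "S0 \<subseteq> S" "T0 \<subseteq> T" and r: "card S = card S0 + r" "card T = card T0 + r"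
  shows "quad_form V (\<lambda>u v. real (split_dist S T u v)) (block_vector S0 T0 a b c) =
    block_form (real (card V)) (real (card S0)) (real (card T0)) (real r) a b c"
proof -
  define n s t where "n = real (card V)" and "s = real (card S0)" and "t = real (card T0)"
  let ?x = "block_vector S0 T0 a b c"
  have finST: "finite S" "finite T" using fin ST(1,2) by (auto intro: finite_subset)
  have V: "(\<Sum>v\<in>V. f (?x v)) = s * f a + t * f c + (n - s - t) * f b" for f
    unfolding s_def t_def n_def using fin ST sub by (intro sum_block_vector) auto
  have T: "(\<Sum>v\<in>T. f (?x v)) = t * f c + r * f b" for f :: "real \<Rightarrow> real"
  proof -
    have "(\<Sum>v\<in>T. f (?x v)) = (\<Sum>v\<in>T. f (block_vector {} T0 a b c v))"
      using ST sub by (intro sum.cong) (auto simp: block_vector_def)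
    also have "\<dots> = t * f c + r * f b"
      using sum_block_vector[of T "{}" T0 f a b c] finST sub r by (simp add: t_def)
    finally show ?thesis .
  qed
  have "real (card (V - S - T)) = n - s - t - 2 * r"
  proof -
    have "card V = card (S \<union> (T \<union> (V - S - T)))" using ST by (intro arg_cong[where f = card]) blast
    also have "\<dots> = card S + (card T + card (V - S - T))"
      by (rule card_Un3[OF finST]) (use fin ST in auto)
    finally show ?thesis using r by (simp add: n_def s_def t_def)
  qed
  moreover have "(\<Sum>v\<in>V - S - T. ?x v) = (\<Sum>v\<in>V - S - T. b)"
    using sub by (intro sum.cong) (auto simp: block_vector_def)
  ultimately have C: "sum ?x (V - S - T) = (n - s - t - 2 * r) * b" by simp
  show ?thesis
    unfolding quad_form_split_dist[OF fin ST] C V[of "\<lambda>t. t\<^sup>2"] T[of "\<lambda>t. t\<^sup>2"]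
      V[of "\<lambda>t. t"] T[of "\<lambda>t. t"]
    by (simp add: block_form_def n_def s_def t_def)
qed

text \<open>
The eigenvalue equations determine \<open>x\<close> on each part from the sums \<open>X\<close>, \<open>XT\<close>, \<open>XC\<close> of \<open>x\<close> over \<open>V\<close>, \<open>T\<close>
and \<open>V - S - T\<close>: \<open>(m + 1) a = X\<close>, \<open>(m + 1) b = X + XT\<close> and \<open>(m + 2) c = X + XT + XC\<close>. All
three are positive since \<open>X > 0\<close>, and \<open>XC \<le> X\<close> gives \<open>c \<le> 2b\<close>.
\<close>

lemma split_dist_perron_vector:
  fixes x :: "'a \<Rightarrow> real"
  assumes fin: "finite V" and ST: "S \<subseteq> V" "T \<subseteq> V" "S \<inter> T = {}"
    and x: "\<And>v. v \<in> V \<Longrightarrow> x v \<ge> 0" "(\<Sum>v\<in>V. (x v)\<^sup>2) = 1"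
    and eig: "\<And>u. u \<in> V \<Longrightarrow> (\<Sum>v\<in>V. real (split_dist S T u v) * x v) = m * x u"
  obtains a b c where "0 < a" "0 < b" "0 < c" "c \<le> 2 * b"
    "\<And>v. v \<in> V \<Longrightarrow> x v = block_vector S T a b c v"
proof -
  define X XT XC where "X = sum x V" and "XT = sum x T" and "XC = sum x (V - S - T)"
  have XT: "XT \<ge> 0" unfolding XT_def using x(1) ST by (intro sum_nonneg) auto
  have XC: "XC \<ge> 0" unfolding XC_def using x(1) by (intro sum_nonneg) auto
  have XCX: "XC \<le> X" unfolding XC_def X_def using x(1) fin by (intro sum_mono2) auto
  have X: "X > 0"
  proof (rule ccontr)
    assume "\<not> X > 0"
    then have "X = 0" using x(1) by (simp add: X_def sum_nonneg order_antisym)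
    then have "\<forall>v\<in>V. x v = 0" using x(1) fin by (simp add: X_def sum_nonneg_eq_0_iff)
    then show False using x(2) by simp
  qed
  have m: "m \<ge> 0"
  proof -
    have "(\<Sum>u\<in>V. x u * (\<Sum>v\<in>V. real (split_dist S T u v) * x v)) = (\<Sum>u\<in>V. x u * (m * x u))"
      using eig by simp
    also have "\<dots> = m * (\<Sum>v\<in>V. (x v)\<^sup>2)"
      by (simp add: sum_distrib_left power2_eq_square mult_ac)
    also have "\<dots> = m" by (simp add: x(2))
    finally show ?thesis using x(1) by (metis (no_types, lifting) mult_nonneg_nonneg of_nat_0_le_iff sum_nonneg)
  qed
  define a b c where "a = X / (m + 1)" and "b = (X + XT) / (m + 1)" and "c = (X + XT + XC) / (m + 2)"
  have "x u = block_vector S T a b c u" if "u \<in> V" for u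
    using eig[OF that] split_dist_sum[OF fin ST that, of x] m ST
    by (auto simp: block_vector_def a_def b_def c_def X_def XT_def XC_def field_simps)
  moreover have "c \<le> 2 * b"
  proof -
    have "c \<le> (2 * (X + XT)) / (m + 2)"
      unfolding c_def using XT XCX m by (intro divide_right_mono) auto
    also have "\<dots> \<le> (2 * (X + XT)) / (m + 1)"
      using X XT m by (intro divide_left_mono) auto
    finally show ?thesis by (simp add: b_def)
  qed
  moreover have "0 < a" "0 < b" "0 < c"
    using X XT XC m by (auto simp: a_def b_def c_def)
  ultimately show thesis using that by blast
qed

section \<open>The extremal graph\<close>

definition extremal_core :: "nat \<Rightarrow> (nat + (nat + nat)) set" where
  "extremal_core \<delta> = Inl ` {..<\<delta>}"

definition extremal_independent :: "nat \<Rightarrow> nat \<Rightarrow> (nat + (nat + nat)) set" where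
  "extremal_independent \<delta> k = Inr ` Inr ` {..<\<delta> + 1 - 2 * k}"

lemma pverts_extremal_graph:
  "pverts (extremal_graph n \<delta> k) =
     extremal_core \<delta> \<union> (extremal_independent \<delta> k \<union> Inr ` Inl ` {..<n + 2 * k - 2 * \<delta> - 1})"
  by (auto simp: extremal_graph_def join_def disjoint_union_def complete_graph_def
      empty_graph_def extremal_core_def extremal_independent_def)

lemma parcs_extremal_graph_iff:
  "(u, v) \<in> parcs (extremal_graph n \<delta> k) \<longleftrightarrow>
     u \<in> pverts (extremal_graph n \<delta> k) \<and> v \<in> pverts (extremal_graph n \<delta> k) \<and>
     split_dist (extremal_core \<delta>) (extremal_independent \<delta> k) u v = 1"
  by (cases u; cases v; (rename_tac a b, case_tac a; case_tac b)?)
    (auto simp: extremal_graph_def join_def disjoint_union_def complete_graph_def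
       empty_graph_def split_dist_def extremal_core_def extremal_independent_def)

lemma pair_graph_extremal_graph: "pair_graph (extremal_graph n \<delta> k)"
  unfolding extremal_graph_def
  by (intro pair_graph_join pair_graph_disjoint_union pair_graph_complete_graph
      pair_graph_empty_graph)

lemma extremal_parts:
  "finite (pverts (extremal_graph n \<delta> k))"
  "extremal_core \<delta> \<subseteq> pverts (extremal_graph n \<delta> k)"
  "extremal_independent \<delta> k \<subseteq> pverts (extremal_graph n \<delta> k)"
  "extremal_core \<delta> \<inter> extremal_independent \<delta> k = {}"
  "card (extremal_core \<delta>) = \<delta>"
  "card (extremal_independent \<delta> k) = \<delta> + 1 - 2 * k"
  by (auto simp: pverts_extremal_graph extremal_core_def extremal_independent_def card_image)

lemma card_extremal_graph:
  assumes "2 * k \<le> \<delta>" "2 * \<delta> + 1 \<le> n + 2 * k"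
  shows "card (pverts (extremal_graph n \<delta> k)) = n"
proof -
  have "card (pverts (extremal_graph n \<delta> k)) =
      \<delta> + ((\<delta> + 1 - 2 * k) + (n + 2 * k - 2 * \<delta> - 1))"
    unfolding pverts_extremal_graph
    by (subst card_Un3) (auto simp: extremal_core_def extremal_independent_def card_image)
  then show ?thesis using assms by simp
qed

text \<open>
The hypothesis \<open>0 < \<delta>\<close> provides a vertex adjacent to all others, so nonadjacent vertices have
distance 2.
\<close>

lemma graph_dist_extremal_graph:
  assumes uv: "u \<in> pverts (extremal_graph n \<delta> k)" "v \<in> pverts (extremal_graph n \<delta> k)"
    and "0 < \<delta>"
  shows "graph_dist (extremal_graph n \<delta> k) u v =
    split_dist (extremal_core \<delta>) (extremal_independent \<delta> k) u v"
proof -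
  let ?H = "extremal_graph n \<delta> k" and ?d = "split_dist (extremal_core \<delta>) (extremal_independent \<delta> k)"
  note H = pair_graph_extremal_graph[of n \<delta> k]
  consider "u = v" | "u \<noteq> v" "(u, v) \<in> parcs ?H" | "u \<noteq> v" "(u, v) \<notin> parcs ?H" by blast
  then show ?thesis
  proof cases
    case 1
    then show ?thesis using graph_dist_self[OF H uv(1)] by (simp add: split_dist_def)
  next
    case 2
    then show ?thesis using graph_dist_adjacent[OF H 2(2)] by (simp add: parcs_extremal_graph_iff)
  next
    case 3
    then have "?d u v \<noteq> 1" using uv by (simp add: parcs_extremal_graph_iff)
    then have d: "?d u v = 2" and "u \<notin> extremal_core \<delta>" "v \<notin> extremal_core \<delta>"
      using 3(1) extremal_parts(4) by (auto simp: split_dist_def split: if_splits)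
    moreover have hub: "Inl 0 \<in> extremal_core \<delta>" "Inl 0 \<notin> extremal_independent \<delta> k"
      using assms(3) by (auto simp: extremal_core_def extremal_independent_def)
    moreover have "Inl 0 \<in> pverts ?H" using hub(1) extremal_parts(2) by blast
    ultimately have "(u, Inl 0) \<in> parcs ?H" "(Inl 0, v) \<in> parcs ?H"
      using uv by (auto simp: parcs_extremal_graph_iff split_dist_def)
    then show ?thesis using graph_dist_common_neighbour[OF H 3] d by simp
  qed
qed

lemma quad_form_cong:
  assumes "\<And>u v. u \<in> V \<Longrightarrow> v \<in> V \<Longrightarrow> d u v = d' u v" "\<And>v. v \<in> V \<Longrightarrow> x v = y v"
  shows "quad_form V d x = quad_form V d' y"
  unfolding quad_form_def using assms by (intro sum.cong refl) simp

text \<open>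
The vector is normalized, so that its Rayleigh quotient is the value of the quadratic form.
\<close>

lemma extremal_perron_vector:
  fixes n \<delta> k :: nat
  assumes "0 < \<delta>"
  defines "V \<equiv> pverts (extremal_graph n \<delta> k)"
    and "S \<equiv> extremal_core \<delta>" and "T \<equiv> extremal_independent \<delta> k"
  obtains a b c where "0 < a" "0 < b" "0 < c" "c \<le> 2 * b"
    "(\<Sum>v\<in>V. (block_vector S T a b c v)\<^sup>2) = 1"
    "quad_form V (\<lambda>u v. real (split_dist S T u v)) (block_vector S T a b c) =
       distance_spectral_radius (extremal_graph n \<delta> k)"
proof -
  let ?H = "extremal_graph n \<delta> k"
  define m where "m = distance_spectral_radius ?H"
  have parts: "finite V" "S \<subseteq> V" "T \<subseteq> V" "S \<inter> T = {}"
    unfolding V_def S_def T_def by (rule extremal_parts)+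
  have "Inl 0 \<in> S" using assms(1) by (simp add: S_def extremal_core_def)
  then have ne: "V \<noteq> {}" using parts(2) by blast
  have d: "graph_dist ?H u v = split_dist S T u v" if "u \<in> V" "v \<in> V" for u v
    using graph_dist_extremal_graph that assms(1) unfolding V_def S_def T_def by blast
  have perron: "\<exists>x. (\<forall>v\<in>V. x v \<ge> 0) \<and> (\<Sum>v\<in>V. (x v)\<^sup>2) = 1 \<and>
      (\<forall>u\<in>V. (\<Sum>v\<in>V. real (graph_dist ?H u v) * x v) = m * x u)"
    unfolding V_def m_def
    by (rule distance_spectral_radius_perron(2))
      (use parts(1) ne graph_dist_commute[OF pair_graph_extremal_graph] in \<open>auto simp: V_def\<close>)
  obtain x where x: "\<And>v. v \<in> V \<Longrightarrow> x v \<ge> 0" "(\<Sum>v\<in>V. (x v)\<^sup>2) = 1"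
    and eig: "\<And>u. u \<in> V \<Longrightarrow> (\<Sum>v\<in>V. real (graph_dist ?H u v) * x v) = m * x u"
    using perron by blast
  have eig': "(\<Sum>v\<in>V. real (split_dist S T u v) * x v) = m * x u" if "u \<in> V" for u
    using eig[OF that] d[OF that] by simp
  obtain a b c where abc: "0 < a" "0 < b" "0 < c" "c \<le> 2 * b"
    and xt: "\<And>v. v \<in> V \<Longrightarrow> x v = block_vector S T a b c v"
    using split_dist_perron_vector[OF parts x eig'] by blast
  have "quad_form V (\<lambda>u v. real (split_dist S T u v)) (block_vector S T a b c) =
      quad_form V (\<lambda>u v. real (split_dist S T u v)) x"
    using xt by (intro quad_form_cong) auto
  also have "\<dots> = (\<Sum>u\<in>V. x u * (\<Sum>v\<in>V. real (split_dist S T u v) * x v))"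
    by (simp add: quad_form_def sum_distrib_left mult_ac)
  also have "\<dots> = (\<Sum>u\<in>V. x u * (m * x u))"
    using eig' by simp
  also have "\<dots> = m * (\<Sum>v\<in>V. (x v)\<^sup>2)"
    by (simp add: sum_distrib_left power2_eq_square mult_ac)
  finally have "quad_form V (\<lambda>u v. real (split_dist S T u v)) (block_vector S T a b c) = m"
    using x(2) by simp
  moreover have "(\<Sum>v\<in>V. (block_vector S T a b c v)\<^sup>2) = 1" using x(2) xt by simp
  ultimately show thesis using that abc unfolding m_def by blast
qed

section \<open>Comparison of spectral radii\<close>

text \<open>
The difference of the two sides is \<open>r b ((r - 1) b + 2 (N - 2r) b - 2 t c)\<close> with \<open>N = n - s - t\<close>. By
\<open>c \<le> 2b\<close> the factor in the outer parentheses is at least \<open>(2N - 3r - 1 - 4t) b\<close>, which is at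
least \<open>(N/2 - 1 - 4t) b\<close> since \<open>r \<le> N/2\<close>.
\<close>

lemma block_form_gain:
  assumes "0 < b" "c \<le> 2 * b" "1 \<le> r" "0 \<le> t" "2 * r \<le> n - s - t" "8 * t + 2 < n - s - t"
  shows "block_form n s t 0 a b c < block_form n s t r a b c"
proof -
  define N where "N = n - s - t"
  have "(2 * t) * c \<le> (2 * t) * (2 * b)" using assms(2,4) by (intro mult_left_mono) auto
  moreover have "0 < (r - 1 + 2 * (N - 2 * r) - 4 * t) * b"
    using assms by (intro mult_pos_pos) (auto simp: N_def)
  ultimately have "0 < (r - 1 + 2 * (N - 2 * r)) * b - 2 * t * c"
    by (simp add: algebra_simps)
  then have "0 < r * b * ((r - 1 + 2 * (N - 2 * r)) * b - 2 * t * c)"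
    using assms(1,3) by (intro mult_pos_pos) auto
  then show ?thesis
    unfolding block_form_def N_def[symmetric] by (simp add: power2_eq_square algebra_simps)
qed

text \<open>
The transplanted vector \<open>y\<close> sits on \<open>\<delta>\<close> vertices of \<open>S\<close> and \<open>t\<close> vertices of \<open>T\<close>, so it has the same
entries as the eigenvector of the extremal graph up to order, hence norm 1. The chain
\<open>\<mu>(H) \<le> d\<^sub>S(y, y) \<le> d\<^sub>G(y, y) \<le> \<mu>(G) \<le> \<mu>(H)\<close> is strict at its first step unless \<open>r = 0\<close>. Equality at the
second step forces equality of all distances, because \<open>y\<close> has only positive entries.
\<close>

lemma split_graph_with_small_spectral_radius:
  fixes G :: "'a pair_pre_digraph" and n k \<delta> :: nat
  assumes "1 \<le> k" and delta: "2 * k + 1 \<le> \<delta>" and n: "12 * \<delta> + 1 \<le> n + 2 * k"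
    and G: "pair_graph G" "Digraph_Component.connected (with_proj G)" and card: "card (pverts G) = n"
    and ST: "S \<subseteq> pverts G" "T \<subseteq> pverts G" "S \<inter> T = {}"
    and cardST: "card T + 2 * k = card S + 1" "\<delta> \<le> card S"
    and nb: "\<And>u v. (u, v) \<in> parcs G \<Longrightarrow> u \<in> T \<Longrightarrow> v \<in> S"
    and le: "distance_spectral_radius G \<le> distance_spectral_radius (extremal_graph n \<delta> k)"
  shows "card S = \<delta>"
    and "\<And>u v. u \<in> pverts G \<Longrightarrow> v \<in> pverts G \<Longrightarrow> graph_dist G u v = split_dist S T u v"
proof -
  interpret pair_graph G by fact
  define V where "V = pverts G"
  define H where "H = extremal_graph n \<delta> k"
  define S' T' where "S' = extremal_core \<delta>" and "T' = extremal_independent \<delta> k"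
  define t where "t = \<delta> + 1 - 2 * k"
  define r where "r = card S - \<delta>"
  have fin: "finite V" by (simp add: V_def pair_finite_verts)
  have ST': "S \<subseteq> V" "T \<subseteq> V" using ST by (simp_all add: V_def)
  have finST: "finite S" "finite T" using ST' fin by (auto intro: finite_subset)
  have r: "card S = \<delta> + r" "card T = t + r" using cardST delta by (auto simp: r_def t_def)
  have "card S + card T \<le> n"
    using card_mono[OF fin, of "S \<union> T"] ST' ST(3) finST card by (simp add: V_def card_Un_disjoint)
  then have nr: "\<delta> + t + 2 * r \<le> n" using r by simp
  obtain S0 where S0: "S0 \<subseteq> S" "card S0 = \<delta>"
    using obtain_subset_with_card_n[of \<delta> S] r by auto
  obtain T0 where T0: "T0 \<subseteq> T" "card T0 = t"
    using obtain_subset_with_card_n[of t T] r by auto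
  have parts: "finite (pverts H)" "S' \<subseteq> pverts H" "T' \<subseteq> pverts H" "S' \<inter> T' = {}"
    unfolding H_def S'_def T'_def by (rule extremal_parts)+
  have cards: "card S' = \<delta>" "card T' = t" "card (pverts H) = n"
    using delta n by (simp_all add: S'_def T'_def H_def t_def extremal_parts(5,6) card_extremal_graph)
  have "0 < \<delta>" using delta by simp
  then obtain a b c where abc: "0 < a" "0 < b" "0 < c" "c \<le> 2 * b"
    and one: "(\<Sum>v\<in>pverts H. (block_vector S' T' a b c v)\<^sup>2) = 1"
    and rho: "quad_form (pverts H) (\<lambda>u v. real (split_dist S' T' u v)) (block_vector S' T' a b c) =
       distance_spectral_radius H"
    unfolding H_def S'_def T'_def by (rule extremal_perron_vector)
  define y where "y = block_vector S0 T0 a b c"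
  have y: "y v > 0" for v using abc by (simp add: y_def block_vector_def)
  define dS dG where "dS u v = real (split_dist S T u v)" and "dG u v = real (graph_dist G u v)" for u v
  have dSG: "dS u v \<le> dG u v" if "u \<in> V" "v \<in> V" for u v
    using split_dist_le_graph_dist[OF G nb] that by (auto simp: dS_def dG_def V_def)
  have "(\<Sum>v\<in>V. (y v)\<^sup>2) = 1"
    using one fin ST' ST(3) S0 T0 parts cards card unfolding y_def
    by (subst sum_block_vector; (subst (asm) sum_block_vector)?) (auto simp: V_def)
  moreover have "quad_form V dG y \<le> distance_spectral_radius G * (\<Sum>v\<in>V. (y v)\<^sup>2)"
  proof -
    have "V \<noteq> {}" using r(1) \<open>0 < \<delta>\<close> ST'(1) by auto
    then show ?thesis
      unfolding V_def dG_def
      using fin graph_dist_commute[OF G(1)]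
      by (intro distance_spectral_radius_perron(1)) (auto simp: V_def)
  qed
  ultimately have QG: "quad_form V dG y \<le> distance_spectral_radius H"
    using le by (simp add: H_def)
  have QSG: "quad_form V dS y \<le> quad_form V dG y"
    unfolding quad_form_def using dSG y
    by (intro sum_mono mult_right_mono) (auto intro: less_imp_le)
  have QS: "quad_form V dS y = block_form n \<delta> t r a b c"
    using quad_form_block_vector[OF fin ST' ST(3) S0(1) T0(1), of r a b c] r S0(2) T0(2) card
    by (simp add: dS_def[abs_def] y_def V_def)
  have QH: "distance_spectral_radius H = block_form n \<delta> t 0 a b c"
    using quad_form_block_vector[OF parts order_refl order_refl, of 0 a b c] cards rho by simp
  have r0: "r = 0"
  proof (rule ccontr)
    assume "r \<noteq> 0"
    moreover have "2 * real r \<le> real n - \<delta> - t" using nr by linarith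
    \<comment> \<open>The bound on \<open>n\<close> gives \<open>n - \<delta> - t \<ge> 10 \<delta>\<close>, and \<open>t < \<delta>\<close> because \<open>k \<ge> 1\<close>.\<close>
    moreover have "8 * real t + 2 < real n - \<delta> - t"
      using n delta \<open>1 \<le> k\<close> by (simp add: t_def)
    ultimately have "distance_spectral_radius H < quad_form V dS y"
      unfolding QS QH using abc by (intro block_form_gain) auto
    then show False using QSG QG by simp
  qed
  then show "card S = \<delta>" using r by simp
  have "quad_form V dS y = distance_spectral_radius H" unfolding QS QH r0 by simp
  then have "quad_form V dG y = quad_form V dS y" using QSG QG by simp
  then have zero: "(\<Sum>u\<in>V. \<Sum>v\<in>V. (dG u v - dS u v) * (y u * y v)) = 0"
    by (simp add: quad_form_def algebra_simps sum_subtractf)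
  have nonneg: "0 \<le> (dG u v - dS u v) * (y u * y v)" if "u \<in> V" "v \<in> V" for u v
    using dSG[OF that] y by (intro mult_nonneg_nonneg) (auto intro: less_imp_le)
  have "(dG u v - dS u v) * (y u * y v) = 0" if "u \<in> V" "v \<in> V" for u v
  proof -
    have "(\<Sum>v\<in>V. (dG u v - dS u v) * (y u * y v)) = 0"
      using zero that(1) nonneg fin by (subst (asm) sum_nonneg_eq_0_iff) (auto intro: sum_nonneg)
    then show ?thesis
      using that nonneg fin by (subst (asm) sum_nonneg_eq_0_iff) auto
  qed
  moreover have "y u * y v \<noteq> 0" for u v using y[of u] y[of v] by simp
  ultimately show "graph_dist G u v = split_dist S T u v"
    if "u \<in> pverts G" "v \<in> pverts G" for u v
    using that by (fastforce simp: V_def dG_def dS_def)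
qed

section \<open>Isomorphism with the extremal graph\<close>

lemma digraph_iso_of_bij_betw:
  assumes G: "pair_graph G"
    and bij: "bij_betw g (pverts G) (pverts H)"
    and H: "\<And>u v. (u, v) \<in> parcs H \<Longrightarrow> u \<in> pverts H \<and> v \<in> pverts H"
    and arcs: "\<And>u v. u \<in> pverts G \<Longrightarrow> v \<in> pverts G \<Longrightarrow> (u, v) \<in> parcs G \<longleftrightarrow> (g u, g v) \<in> parcs H"
  shows "digraph_iso (with_proj G) (with_proj H)"
proof -
  interpret pair_graph G by fact
  define f where
    "f = \<lparr> iso_verts = g, iso_arcs = map_prod g g, iso_head = snd, iso_tail = fst \<rparr>"
  have inj: "inj_on g (pverts G)" and img: "g ` pverts G = pverts H"
    using bij by (auto simp: bij_betw_def)
  have "inj_on (map_prod g g) (pverts G \<times> pverts G)" by (rule map_prod_inj_on[OF inj inj])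
  then have "inj_on (map_prod g g) (parcs G)"
    by (rule inj_on_subset) (auto dest: wellformed')
  moreover have "wf_digraph (with_proj G)" by unfold_locales
  ultimately have "pre_digraph.digraph_isomorphism (with_proj G) f"
    using inj by (simp add: pre_digraph.digraph_isomorphism_def f_def)
  moreover have "map_prod g g ` parcs G = parcs H"
  proof
    show "map_prod g g ` parcs G \<subseteq> parcs H"
    proof clarify
      fix u v assume uv: "(u, v) \<in> parcs G"
      then have "u \<in> pverts G" "v \<in> pverts G" by (rule wellformed')+
      then show "(g u, g v) \<in> parcs H" using arcs uv by simp
    qed
    show "parcs H \<subseteq> map_prod g g ` parcs G"
    proof clarify
      fix u v assume uv: "(u, v) \<in> parcs H"
      then obtain u' v' where "u' \<in> pverts G" "v' \<in> pverts G" "u = g u'" "v = g v'"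
        using H[OF uv] unfolding img[symmetric] by blast
      then have "(u', v') \<in> parcs G" "(u, v) = map_prod g g (u', v')"
        using uv arcs[of u' v'] by simp_all
      then show "(u, v) \<in> map_prod g g ` parcs G" by (rule rev_image_eqI)
    qed
  qed
  then have "with_proj H = app_iso f (with_proj G)"
    using img by (simp add: app_iso_def f_def with_proj_def)
  ultimately show ?thesis unfolding digraph_iso_def by blast
qed

lemma bij_betw_matching_parts:
  assumes fin: "finite V" "finite V'"
    and parts: "S \<subseteq> V" "T \<subseteq> V" "S \<inter> T = {}" "S' \<subseteq> V'" "T' \<subseteq> V'" "S' \<inter> T' = {}"
    and card: "card S = card S'" "card T = card T'" "card V = card V'"
  obtains g where "bij_betw g V V'"
    "\<And>v. v \<in> V \<Longrightarrow> g v \<in> S' \<longleftrightarrow> v \<in> S" "\<And>v. v \<in> V \<Longrightarrow> g v \<in> T' \<longleftrightarrow> v \<in> T"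
proof -
  define C C' where "C = V - (S \<union> T)" and "C' = V' - (S' \<union> T')"
  have fins: "finite S" "finite T" "finite S'" "finite T'" "finite C" "finite C'"
    using fin parts by (auto simp: C_def C'_def intro: finite_subset)
  have "card C = card C'"
    unfolding C_def C'_def using fins parts card
    by (simp add: card_Diff_subset card_Un_disjoint)
  then obtain p q r where p: "bij_betw p S S'" and q: "bij_betw q T T'" and r: "bij_betw r C C'"
    using card fins finite_same_card_bij by metis
  define g where "g v = (if v \<in> S then p v else if v \<in> T then q v else r v)" for v
  have gS: "bij_betw g S S'" using p by (rule bij_betw_cong[THEN iffD1, rotated]) (simp add: g_def)
  have gT: "bij_betw g T T'"
    using q by (rule bij_betw_cong[THEN iffD1, rotated]) (use parts in \<open>auto simp: g_def\<close>)
  have gC: "bij_betw g C C'"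
    using r by (rule bij_betw_cong[THEN iffD1, rotated]) (auto simp: g_def C_def)
  have "bij_betw g (S \<union> (T \<union> C)) (S' \<union> (T' \<union> C'))"
    using gS gT gC parts by (intro bij_betw_combine) (auto simp: C'_def)
  moreover have "S \<union> (T \<union> C) = V" "S' \<union> (T' \<union> C') = V'" using parts by (auto simp: C_def C'_def)
  ultimately have "bij_betw g V V'" by simp
  moreover have "g v \<in> S' \<longleftrightarrow> v \<in> S" "g v \<in> T' \<longleftrightarrow> v \<in> T" if "v \<in> V" for v
  proof -
    have "v \<in> S \<Longrightarrow> g v \<in> S'" "v \<in> T \<Longrightarrow> g v \<in> T'" "v \<in> C \<Longrightarrow> g v \<in> C'"
      using gS gT gC by (auto dest: bij_betwE)
    then show "g v \<in> S' \<longleftrightarrow> v \<in> S" "g v \<in> T' \<longleftrightarrow> v \<in> T"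
      using that parts unfolding C_def C'_def by blast+
  qed
  ultimately show thesis using that by blast
qed

lemma parcs_iff_graph_dist_eq_1:
  assumes G: "pair_graph G" "Digraph_Component.connected (with_proj G)"
    and uv: "u \<in> pverts G" "v \<in> pverts G"
  shows "(u, v) \<in> parcs G \<longleftrightarrow> graph_dist G u v = 1"
proof
  show "graph_dist G u v = 1" if "(u, v) \<in> parcs G" by (rule graph_dist_adjacent[OF G(1) that])
  assume d: "graph_dist G u v = 1"
  obtain p where p: "pre_digraph.apath (with_proj G) u p v" using connected_imp_apath[OF G uv] by blast
  have "u \<noteq> v" using d graph_dist_self[OF G(1) uv(1)] by auto
  then show "(u, v) \<in> parcs G" using d graph_dist_ge_2[OF G(1) p] by fastforce
qed

theorem theorem1p7:
  fixes G :: "'a pair_pre_digraph" and n k \<delta> :: nat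
  assumes "k \<ge> 1"
    and "pair_graph G"
    and "Digraph_Component.connected (with_proj G)"
    and "card (pverts G) = n"
    and "min_degree G = \<delta>"
    and "int n \<ge> 12 * int \<delta> - 2 * int k + 1"
    and "\<delta> \<ge> 2 * k + 1"
    and "distance_spectral_radius G \<le> distance_spectral_radius (extremal_graph n \<delta> k)"
    and "\<not> digraph_iso (with_proj G) (with_proj (extremal_graph n \<delta> k))"
  shows "fractional_extendable k G"
proof (rule ccontr)
  assume not_ext: "\<not> fractional_extendable k G"
  interpret pair_graph G by fact
  let ?H = "extremal_graph n \<delta> k" and ?S' = "extremal_core \<delta>" and ?T' = "extremal_independent \<delta> k"
  have n: "12 * \<delta> + 1 \<le> n + 2 * k" using assms(6) by linarith
  have "2 * k + 2 \<le> card (pverts G)" "2 * k \<le> min_degree G" using n assms(4,5,7) by auto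
  then obtain S T where ST: "S \<subseteq> pverts G" "T \<subseteq> pverts G" "S \<inter> T = {}"
    and cardST: "card T + 2 * k = card S + 1" "\<delta> \<le> card S"
    and nb: "\<And>u v. (u, v) \<in> parcs G \<Longrightarrow> u \<in> T \<Longrightarrow> v \<in> S"
    using not_fractional_extendable_imp_split[OF assms(2) _ _ not_ext] assms(5) by blast
  have cardS: "card S = \<delta>"
    by (rule split_graph_with_small_spectral_radius(1)[OF assms(1,7) n assms(2-4) ST cardST _ assms(8)])
      (rule nb)
  have dist: "graph_dist G u v = split_dist S T u v" if "u \<in> pverts G" "v \<in> pverts G" for u v
    by (rule split_graph_with_small_spectral_radius(2)[OF assms(1,7) n assms(2-4) ST cardST _ assms(8) that])
      (rule nb)
  have cards: "card S = card ?S'" "card T = card ?T'" "card (pverts G) = card (pverts ?H)"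
    using cardST cardS assms(4,7) n by (simp_all add: extremal_parts(5,6) card_extremal_graph)
  obtain g where g: "bij_betw g (pverts G) (pverts ?H)"
    "\<And>v. v \<in> pverts G \<Longrightarrow> g v \<in> ?S' \<longleftrightarrow> v \<in> S" "\<And>v. v \<in> pverts G \<Longrightarrow> g v \<in> ?T' \<longleftrightarrow> v \<in> T"
    using bij_betw_matching_parts[OF pair_finite_verts extremal_parts(1) ST extremal_parts(2-4) cards]
    by blast
  have "(u, v) \<in> parcs G \<longleftrightarrow> (g u, g v) \<in> parcs ?H" if uv: "u \<in> pverts G" "v \<in> pverts G" for u v
  proof -
    have "g u = g v \<longleftrightarrow> u = v" using g(1) uv by (auto simp: bij_betw_def inj_on_def)
    then have "split_dist S T u v = split_dist ?S' ?T' (g u) (g v)"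
      using g(2,3) uv by (simp add: split_dist_def)
    moreover have "g u \<in> pverts ?H" "g v \<in> pverts ?H" using g(1) uv by (auto dest: bij_betwE)
    ultimately show ?thesis
      using parcs_iff_graph_dist_eq_1[OF assms(2,3) uv] dist[OF uv]
      by (simp add: parcs_extremal_graph_iff)
  qed
  then have "digraph_iso (with_proj G) (with_proj ?H)"
    using g(1) by (intro digraph_iso_of_bij_betw[OF assms(2)]) (auto simp: parcs_extremal_graph_iff)
  then show False using assms(9) by contradiction
qed

end
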